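(* Let $f:\mathbb{D}\to\widehat{\mathbb{C}}$ be spherically convex. Then $$L_s f(r\mathbb{T})\ge\frac{2\pi r f^{\sharp}(0)}{1+r^2f^{\sharp}(0)^2}\quad\text{for every } 0<r<1.$$ Moreover, equality holds for any $0<r<1$ if $f$ has the form $f(z)=T(\eta z)$ with $T\in\mathrm{Rot}(\widehat{\mathbb{C}})$ and $0<|\eta|\le 1$ ($\eta\in\mathbb{C}$).
   Context: $\mathbb{D}=\{z\in\mathbb{C}:|z|<1\}$, $\mathbb{T}=\partial\mathbb{D}$, $r\mathbb{T}=\{|z|=r\}$; $\widehat{\mathbb{C}}=\mathbb{C}\cup\{\infty\}$ is the Riemann sphere with the spherical metric $\frac{|dz|}{1+|z|^2}$ (Gaussian curvature $+4$). For two non-antipodal points $a,b\in\widehat{\mathbb{C}}$, the spherical geodesic joining them is the smaller arc of the great circle through $a$ and $b$. A domain $\Omega\subset\widehat{\mathbb{C}}$ is spherically convex if for any two points $a,b\in\Omega$ that are not antipodal the spherical geodesic joining $a$ and $b$ lies in $\Omega$. A meromorphic univalent (injective) map $f:\mathbb{D}\to\widehat{\mathbb{C}}$ is called spherically convex if $f(\mathbb{D})$ is a spherically convex domain. The group of (meromorphic) spherical isometries is $$\mathrm{Rot}(\widehat{\mathbb{C}})=\left\{e^{i\theta}\frac{z-a}{1+z\overline{a}}: a\in\mathbb{C},\theta\in\mathbb{R}\right\}\cup\left\{\frac{e^{i\theta}}{z}:\theta\in\mathbb{R}\right\}.$$ The spherical derivative is $f^{\sharp}(z)=\frac{|f'(z)|}{1+|f(z)|^2}$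 (at a pole of $f$ defined by continuous extension), and $$L_s f(r\mathbb{T})=\int_{r\mathbb{T}}f^{\sharp}(z)\,|dz|.$$ *)

theory Defs
  imports "HOL-Complex_Analysis.Complex_Analysis"
begin

section \<open>The Riemann sphere\<close>

text \<open>The Riemann sphere is the one-point compactification of the plane: \<open>None\<close> is the point
  at infinity.\<close>

type_synonym rsphere = "complex option"

definition rsphere_top :: "rsphere topology" where
  "rsphere_top = Alexandroff_compactification euclidean"

text \<open>Stereographic projection onto the unit sphere of \<open>\<complex> \<times> \<real>\<close>. It pulls the
  Euclidean arc length of that sphere back to \<open>2 |dz| / (1 + |z|\<^sup>2)\<close>, twice the spherical
  metric \<open>|dz| / (1 + |z|\<^sup>2)\<close> of curvature \<open>+4\<close>; great circles, arcs and antipodes are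
  the same for both.\<close>

fun stereo :: "rsphere \<Rightarrow> complex \<times> real" where
  "stereo None = (0, 1)"
| "stereo (Some z) =
     ((2 / (1 + (cmod z)\<^sup>2)) *\<^sub>R z, ((cmod z)\<^sup>2 - 1) / ((cmod z)\<^sup>2 + 1))"

lemma stereo_in_sphere: "stereo a \<in> sphere 0 1"
proof (cases a)
  case (Some z)
  define t where "t = (cmod z)\<^sup>2"
  have t: "t \<ge> 0" by (simp add: t_def)
  have "(2 / (1 + t))\<^sup>2 * t + ((t - 1) / (t + 1))\<^sup>2 = (4 * t + (t - 1)\<^sup>2) / (t + 1)\<^sup>2"
    by (simp add: power_divide add_divide_distrib add.commute)
  also have "4 * t + (t - 1)\<^sup>2 = (t + 1)\<^sup>2"
    by (simp add: power2_eq_square algebra_simps)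
  also have "\<dots> / (t + 1)\<^sup>2 = 1"
    using t by simp
  finally have "(norm (stereo a))\<^sup>2 = 1"
    using Some by (simp add: norm_Pair power_mult_distrib power_divide t_def)
  then show ?thesis
    by (simp add: power2_eq_1_iff) (smt (verit) norm_ge_zero)
qed (simp add: norm_Pair)

definition antipodal :: "rsphere \<Rightarrow> rsphere \<Rightarrow> bool" where
  "antipodal a b \<longleftrightarrow> stereo b = - stereo a"

text \<open>For non-antipodal points \<open>p, q\<close> of the unit sphere, the smaller arc of the great circle
  through \<open>p\<close> and \<open>q\<close> is the radial projection (\<^const>\<open>sgn\<close>) of the chord from \<open>p\<close> to \<open>q\<close>.
  For \<open>p = q\<close> it degenerates to that point.\<close>

definition spherical_geodesic :: "rsphere \<Rightarrow> rsphere \<Rightarrow> rsphere set" where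
  "spherical_geodesic a b = {x. stereo x \<in> sgn ` closed_segment (stereo a) (stereo b)}"

lemma spherical_geodesic_subset_great_circle:
  "stereo ` spherical_geodesic a b \<subseteq> sphere 0 1 \<inter> span {stereo a, stereo b}"
proof -
  have "closed_segment (stereo a) (stereo b) \<subseteq> span {stereo a, stereo b}"
    by (intro closed_segment_subset) (auto intro: span_base subspace_imp_convex)
  then have "sgn ` closed_segment (stereo a) (stereo b) \<subseteq> span {stereo a, stereo b}"
    unfolding sgn_div_norm by (blast intro: span_scale)
  then show ?thesis
    using stereo_in_sphere unfolding spherical_geodesic_def by blast
qed

definition spherically_convex_domain :: "rsphere set \<Rightarrow> bool" where
  "spherically_convex_domain \<Omega> \<longleftrightarrow>
     \<Omega> \<noteq> {} \<and> openin rsphere_top \<Omega> \<and> connectedin rsphere_top \<Omega> \<and>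
     (\<forall>a\<in>\<Omega>. \<forall>b\<in>\<Omega>. \<not> antipodal a b \<longrightarrow> spherical_geodesic a b \<subseteq> \<Omega>)"


section \<open>Meromorphic maps into the sphere\<close>

text \<open>The complex-valued representative of a sphere-valued map, with the value \<open>0\<close> at
  \<open>\<infinity>\<close>. This is the convention of \<^const>\<open>nicely_meromorphic_on\<close> for the value at a pole.\<close>

definition affine_part :: "('a \<Rightarrow> rsphere) \<Rightarrow> 'a \<Rightarrow> complex" where
  "affine_part f z = (case f z of None \<Rightarrow> 0 | Some w \<Rightarrow> w)"

definition meromorphic_map_on :: "(complex \<Rightarrow> rsphere) \<Rightarrow> complex set \<Rightarrow> bool" where
  "meromorphic_map_on f A \<longleftrightarrow>
     affine_part f nicely_meromorphic_on A \<and>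
     (\<forall>z\<in>A. f z = None \<longleftrightarrow> is_pole (affine_part f) z)"

definition spherically_convex :: "(complex \<Rightarrow> rsphere) \<Rightarrow> bool" where
  "spherically_convex f \<longleftrightarrow>
     meromorphic_map_on f (ball 0 1) \<and> inj_on f (ball 0 1) \<and>
     spherically_convex_domain (f ` ball 0 1)"


section \<open>Spherical isometries\<close>

text \<open>The map \<open>z \<mapsto> (a z + b) / (c z + d)\<close> of the sphere, for \<open>a d - b c \<noteq> 0\<close>.\<close>

fun moebius_map :: "complex \<Rightarrow> complex \<Rightarrow> complex \<Rightarrow> complex \<Rightarrow> rsphere \<Rightarrow> rsphere" where
  "moebius_map a b c d None = (if c = 0 then None else Some (a / c))"
| "moebius_map a b c d (Some z) =
     (if c * z + d = 0 then None else Some ((a * z + b) / (c * z + d)))"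

definition Rot :: "(rsphere \<Rightarrow> rsphere) set" where
  "Rot = {moebius_map (cis \<theta>) (- cis \<theta> * a) (cnj a) 1 | a \<theta>. True}
       \<union> {moebius_map 0 (cis \<theta>) 1 0 | \<theta>. True}"


section \<open>Spherical derivative and spherical length\<close>

definition spherical_deriv :: "(complex \<Rightarrow> rsphere) \<Rightarrow> complex \<Rightarrow> real" where
  "spherical_deriv f z =
     (let g = affine_part f; D = (\<lambda>w. cmod (deriv g w) / (1 + (cmod (g w))\<^sup>2))
      in if f z = None then Lim (at z) D else D z)"

text \<open>The integral of \<open>h\<close> along the path \<open>\<gamma>\<close> with respect to arc length \<open>|dz|\<close>.\<close>

definition arclength_integral :: "(real \<Rightarrow> complex) \<Rightarrow> (complex \<Rightarrow> real) \<Rightarrow> real" where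
  "arclength_integral \<gamma> h =
     integral {0..1} (\<lambda>t. h (\<gamma> t) * cmod (vector_derivative \<gamma> (at t within {0..1})))"

definition spherical_length :: "(complex \<Rightarrow> rsphere) \<Rightarrow> real \<Rightarrow> real" where
  "spherical_length f r = arclength_integral (circlepath 0 r) (spherical_deriv f)"

end

theory Submission
  imports Defs
begin

text \<open>Rotations of the sphere preserve the spherical derivative, so the problem may be moved to any
  convenient position. A spherically convex image that is not the whole sphere contains no
  antipodal pair; hence the cone over it is convex and misses \<open>0\<close>, and a supporting plane
  of that cone shows that the image lies in a hemisphere (\<open>supporting_hemisphere\<close>). Rotating
  this hemisphere onto the unit disc turns \<open>f\<close> into a holomorphic map \<open>g\<close> of the unit
  disc into itself with the same spherical derivative (\<open>hemisphere_lift\<close>,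
  \<open>spherical_deriv_moebius\<close>).

  Let \<open>L(s)\<close> be the spherical length of the image of the circle of radius \<open>s\<close> and
  \<open>A(s)\<close> the spherical area, with multiplicity, of the image of the disc that it bounds; the
  whole sphere has area \<open>\<pi>\<close>. The isoperimetric inequality \<open>L\<^sup>2 \<ge> 4 A (\<pi> - A)\<close>
  (\<open>isoperimetric\<close>) and the Cauchy--Schwarz inequality \<open>L(s)\<^sup>2 \<le> 2 \<pi> s A'(s)\<close> give
  \<open>s A' \<ge> 2 A (\<pi> - A) / \<pi>\<close>, which says that \<open>A / ((\<pi> - A) s\<^sup>2)\<close> is nondecreasing.
  As \<open>s \<rightarrow> 0\<close> this quotient tends to the square of the spherical derivative at \<open>0\<close>. With
  \<open>\<rho>\<close> denoting \<open>r\<close> times that derivative, this reads \<open>A(r) \<ge> \<pi> \<rho>\<^sup>2 / (1 + \<rho>\<^sup>2)\<close>, and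
  inserting it into the isoperimetric inequality gives \<open>L(r) \<ge> 2 \<pi> \<rho> / (1 + \<rho>\<^sup>2)\<close> as long
  as \<open>A(r) \<le> \<pi>/2\<close>. For larger area the same comparison argument gives \<open>L(r) \<ge> \<pi>\<close>,
  and \<open>\<pi>\<close> is the largest value the bound can take.

  The isoperimetric inequality is proved by the method of E. Schmidt, in the Mercator chart
  \<open>w = tan (\<zeta> / 2)\<close>, in which the metric \<open>2 |dw| / (1 + |w|\<^sup>2)\<close> of curvature 1 becomes
  \<open>|d\<zeta>| / cosh (Im \<zeta>)\<close>. A rotation about \<open>0\<close> makes the image curve fill exactly a
  symmetric band \<open>|Im \<zeta>| \<le> H\<close>. At each point its velocity is compared with the unit tangent, at
  the same height, of the circle inscribed in the band. Integrating gives an inequality that is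
  linear in length and area (\<open>mercator_inequality\<close>). Only line integrals occur, so it does not
  matter whether the curve crosses itself.

  For \<open>f(z) = T(\<eta> z)\<close> the spherical derivative is that of \<open>z \<mapsto> \<eta> z\<close>, which is constant
  on circles around \<open>0\<close>, so that the length is explicit (\<open>spherical_length_rotation\<close>).\<close>


section \<open>Comparison with a circle in the Mercator chart\<close>

lemma cosh_sq_less: fixes x H :: real assumes "-H < x" "x < H" shows "(cosh x)^2 < (cosh H)^2"
proof -
  have "cosh \<bar>x\<bar> < cosh H" using assms by (subst cosh_real_nonneg_less_iff) auto
  hence "cosh x < cosh H" by (simp add: abs_if split: if_splits)
  thus ?thesis by (intro power_strict_mono) (auto intro: less_imp_le cosh_real_pos)
qed

text \<open>The integrand is the vertical component of the tangent of the comparison circle, so the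
  integral over \<open>{-H..H}\<close> is one half of what that circle contributes to the inequality below.
  The value comes from the antiderivative
  \<open>cosh H * arcsin (tanh x / tanh H) - arcsin (sinh x / sinh H)\<close>. Each of its two terms has a
  derivative that blows up at \<open>\<plusminus>H\<close>, so it is differentiated in the interior only.\<close>

lemma cap_integral:
  fixes H :: real
  assumes H: "0 \<le> H"
  shows "((\<lambda>x. sqrt ((cosh H)^2 - (cosh x)^2) / cosh x) has_integral pi * (cosh H - 1)) {-H..H}"
proof (cases "H = 0")
  case True thus ?thesis by (auto simp: has_integral_refl)
next
  case False
  hence H: "0 < H" using assms by simp
  define F where "F = (\<lambda>x. cosh H * arcsin (tanh x / tanh H) - arcsin (sinh x / sinh H))"
  have sH: "sinh H > 0" "tanh H > 0" using H by auto
  have bnd: "\<bar>tanh x / tanh H\<bar> \<le> 1" "\<bar>sinh x / sinh H\<bar> \<le> 1" if "x \<in> {-H..H}" for x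
  proof -
    have "tanh x \<le> tanh H" "tanh (-H) \<le> tanh x" "sinh x \<le> sinh H" "sinh (-H) \<le> sinh x"
      using that by (simp_all del: tanh_minus sinh_minus)
    thus "\<bar>tanh x / tanh H\<bar> \<le> 1" "\<bar>sinh x / sinh H\<bar> \<le> 1"
      using sH by (auto simp: abs_le_iff field_simps)
  qed
  have "((\<lambda>x. sqrt ((cosh H)^2 - (cosh x)^2) / cosh x) has_integral F H - F (-H)) {-H..H}"
  proof (rule fundamental_theorem_of_calculus_interior)
    show "continuous_on {-H..H} F" unfolding F_def
      using sH by (intro continuous_intros) (auto simp del: atLeastAtMost_iff dest: bnd[THEN abs_le_D1] bnd[THEN abs_le_D2, unfolded minus_le_iff[of _ "1"]])
    fix x assume x: "x \<in> {-H<..<H}"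
    define S where "S = sqrt ((cosh H)^2 - (cosh x)^2)"
    have lt: "(cosh x)^2 < (cosh H)^2" using cosh_sq_less x by auto
    have S: "S > 0" "S^2 = (cosh H)^2 - (cosh x)^2"
      unfolding S_def using lt by (intro real_sqrt_gt_zero real_sqrt_pow2; linarith)+
    have c: "cosh x > 0" "cosh H > 0" by (auto)
    have s1: "sqrt (1 - (tanh x / tanh H)^2) = S / (cosh x * sinh H)"
    proof (rule real_sqrt_unique)
      show "0 \<le> S / (cosh x * sinh H)" using S sH c by auto
      have "(S / (cosh x * sinh H))^2 = ((cosh H)^2 - (cosh x)^2) / ((cosh x)^2 * (sinh H)^2)"
        by (simp add: S power_divide power_mult_distrib)
      also have "\<dots> = 1 - (tanh x / tanh H)^2"
        using c sH by (simp add: tanh_def field_simps) (simp add: cosh_square_eq algebra_simps)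
      finally show "(S / (cosh x * sinh H))^2 = 1 - (tanh x / tanh H)^2" .
    qed
    have s2: "sqrt (1 - (sinh x / sinh H)^2) = S / sinh H"
    proof (rule real_sqrt_unique)
      show "0 \<le> S / sinh H" using S sH c by auto
      show "(S / (sinh H))^2 = 1 - (sinh x / sinh H)^2"
        using sH by (simp add: S power_divide field_simps) (simp add: cosh_square_eq)
    qed
    have b1: "\<bar>tanh x / tanh H\<bar> < 1" "\<bar>sinh x / sinh H\<bar> < 1"
    proof -
      have "tanh x < tanh H" "tanh (-H) < tanh x" "sinh x < sinh H" "sinh (-H) < sinh x"
        using x by (simp_all del: tanh_minus sinh_minus)
      thus "\<bar>tanh x / tanh H\<bar> < 1" "\<bar>sinh x / sinh H\<bar> < 1"
        using sH by (auto simp: abs_less_iff field_simps)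
    qed
    have b2: "-1 < tanh x / tanh H" "tanh x / tanh H < 1" "-1 < sinh x / sinh H" "sinh x / sinh H < 1"
      using b1 by (simp_all only: abs_less_iff minus_less_iff[of _ "1::real"])
    have d1: "((\<lambda>x. arcsin (tanh x / tanh H)) has_real_derivative
        inverse (sqrt (1 - (tanh x / tanh H)^2)) * ((1 - (tanh x)^2) / tanh H)) (at x)"
      by (rule DERIV_chain2[OF DERIV_arcsin]) (use b2 sH in \<open>auto intro!: derivative_eq_intros\<close>)
    have d2: "((\<lambda>x. arcsin (sinh x / sinh H)) has_real_derivative
        inverse (sqrt (1 - (sinh x / sinh H)^2)) * (cosh x / sinh H)) (at x)"
      by (rule DERIV_chain2[OF DERIV_arcsin]) (use b2 sH in \<open>auto intro!: derivative_eq_intros\<close>)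
    have e: "1 - (tanh x)^2 = 1 / (cosh x)^2" using c by (simp add: tanh_def field_simps) (simp add: cosh_square_eq)
    have "cosh H * (inverse (sqrt (1 - (tanh x / tanh H)^2)) * ((1 - (tanh x)^2) / tanh H))
       - inverse (sqrt (1 - (sinh x / sinh H)^2)) * (cosh x / sinh H) = S / cosh x"
      unfolding s1 s2 e using c sH S(1)
      by (simp add: tanh_def field_simps) (use S(2) in algebra)
    hence "(F has_real_derivative S / cosh x) (at x)" unfolding F_def
      using DERIV_diff[OF DERIV_cmult[OF d1, of "cosh H"] d2] by simp
    thus "(F has_vector_derivative sqrt ((cosh H)^2 - (cosh x)^2) / cosh x) (at x)"
      by (simp add: S_def has_real_derivative_iff_has_vector_derivative)
  qed (use H in auto)
  moreover have "F H - F (-H) = pi * (cosh H - 1)"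
    using sH by (simp add: F_def) (simp add: algebra_simps)
  ultimately show ?thesis by simp
qed

text \<open>Here \<open>(p, q)\<close> is the velocity, in Mercator coordinates, of a curve at height \<open>y\<close>. The
  right-hand side is its inner product with \<open>(- sinh y, \<sigma> * sqrt ((cosh H)\<^sup>2 - (cosh y)\<^sup>2))\<close>,
  divided by \<open>cosh y\<close>. This vector points along the circle inscribed in the band of half-width
  \<open>H\<close>, where that circle has height \<open>y\<close>, and its length is \<open>sinh H\<close>. The claim
  is therefore the Cauchy--Schwarz inequality. The sign \<open>\<sigma>\<close> selects the rising or the falling
  half of the circle.\<close>

lemma comparison_pointwise:
  fixes H y p q :: real
  assumes "\<bar>y\<bar> \<le> H" "\<sigma>\<^sup>2 = 1"
  shows "sinh H * (sqrt (p^2 + q^2) / cosh y) \<ge>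
     \<sigma> * (q * (sqrt ((cosh H)^2 - (cosh y)^2) / cosh y)) - p * tanh y"
proof -
  define S where "S = sqrt ((cosh H)^2 - (cosh y)^2)"
  have "cosh \<bar>y\<bar> \<le> cosh H" using assms by (subst cosh_real_nonneg_le_iff) auto
  hence "(cosh y)^2 \<le> (cosh H)^2" by (intro power_mono) (auto simp: abs_if split: if_splits)
  hence S: "S^2 = (cosh H)^2 - (cosh y)^2" by (simp add: S_def)
  have "(\<sigma> * (q * S) - p * sinh y)^2 \<le> (p^2 + q^2) * ((sinh y)^2 + (\<sigma> * S)^2)"
    using zero_le_power2[of "p * (\<sigma> * S) + q * sinh y"] by (simp add: power2_eq_square algebra_simps)
  also have "(sinh y)^2 + (\<sigma> * S)^2 = (sinh H)^2"
    using assms S by (simp add: power_mult_distrib cosh_square_eq)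
  finally have "\<bar>\<sigma> * (q * S) - p * sinh y\<bar> \<le> sqrt ((p^2 + q^2) * (sinh H)^2)"
    by (rule real_le_rsqrt[OF ord_eq_le_trans[OF power2_abs]])
  also have "\<dots> = sqrt (p^2 + q^2) * sinh H" using assms by (simp add: real_sqrt_mult)
  finally have "(\<sigma> * (q * S) - p * sinh y) / cosh y \<le> (sqrt (p^2 + q^2) * sinh H) / cosh y"
    by (intro divide_right_mono) auto
  thus ?thesis by (simp add: S_def tanh_def diff_divide_distrib mult.commute)
qed

text \<open>Schmidt's argument. The curve meets the two edges of the band at the times \<open>a \<le> b\<close>. Between
  them it is compared with one half of the inscribed circle, and on the remaining two pieces with
  the other half. The comparison term integrates to a difference of values of a primitive
  \<open>F\<close> at the end points, hence depends only on the heights there, and since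
  the curve is closed the pieces add up to the contribution of the complete circle. The integral of
  \<open>p * tanh y\<close> is minus the signed area enclosed.\<close>

lemma mercator_closed_curve_ordered:
  fixes p q y :: "real \<Rightarrow> real" and T H \<sigma> a b :: real
  assumes y: "\<And>t. t \<in> {0..T} \<Longrightarrow> (y has_real_derivative q t) (at t within {0..T})"
    and cp: "continuous_on {0..T} p" and cq: "continuous_on {0..T} q"
    and closed: "y T = y 0" and H: "0 \<le> H"
    and bound: "\<And>t. t \<in> {0..T} \<Longrightarrow> \<bar>y t\<bar> \<le> H"
    and ab: "0 \<le> a" "a \<le> b" "b \<le> T" and \<sigma>: "\<sigma> = 1 \<or> \<sigma> = -1" and ya: "y a = - \<sigma> * H" and yb: "y b = \<sigma> * H"
  shows "sinh H * integral {0..T} (\<lambda>t. sqrt ((p t)\<^sup>2 + (q t)\<^sup>2) / cosh (y t))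
       \<ge> 2 * pi * (cosh H - 1) - integral {0..T} (\<lambda>t. p t * tanh (y t))"
proof -
  define S where "S = (\<lambda>x::real. sqrt ((cosh H)^2 - (cosh x)^2) / cosh x)"
  \<comment> \<open>The function \<^const>\<open>sqrt\<close> is odd and continuous on all reals, so \<open>S\<close> is continuous
    beyond the band too, and its primitive is differentiable up to the edges.\<close>
  define F where "F = (\<lambda>x. integral {-H..x} S)"
  have cS: "continuous_on X S" for X unfolding S_def by (intro continuous_intros) auto
  have FH: "F H = pi * (cosh H - 1)" unfolding F_def S_def using cap_integral[OF H] by (simp add: integral_unique)
  have F0: "F (-H) = 0" by (simp add: F_def)
  have cy: "continuous_on {0..T} y" using y by (rule DERIV_continuous_on)
  have im: "y ` {0..T} \<subseteq> {-H..H}" using bound by (force simp: abs_le_iff)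
  have Fd: "(F has_real_derivative S x) (at x within {-H..H})" if "x \<in> {-H..H}" for x
    unfolding F_def using integral_has_real_derivative[OF cS that] .
  define G where "G = (\<lambda>t. q t * S (y t))"
  define V where "V = (\<lambda>t. sqrt ((p t)\<^sup>2 + (q t)\<^sup>2) / cosh (y t))"
  define W where "W = (\<lambda>t. p t * tanh (y t))"
  have cont: "continuous_on {0..T} G" "continuous_on {0..T} V" "continuous_on {0..T} W"
    unfolding G_def V_def W_def using cy cp cq
    by (auto intro!: continuous_intros continuous_on_compose2[OF cS[of UNIV]])
  have int: "G integrable_on {u..v}" "V integrable_on {u..v}" "W integrable_on {u..v}"
    if "0 \<le> u" "v \<le> T" for u v
    using that cont by (auto intro!: integrable_continuous_interval elim!: continuous_on_subset)
  have piece: "\<tau> * (F (y v) - F (y u)) - integral {u..v} W \<le> sinh H * integral {u..v} V"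
    if uv: "0 \<le> u" "u \<le> v" "v \<le> T" and \<tau>: "\<tau>\<^sup>2 = 1" for u v \<tau>
  proof -
    have "(G has_integral F (y v) - F (y u)) {u..v}"
    proof (rule fundamental_theorem_of_calculus[OF uv(2)])
      fix t assume t: "t \<in> {u..v}"
      hence t': "t \<in> {0..T}" using uv by auto
      have "(F has_real_derivative S (y t)) (at (y t) within y ` {0..T})"
        by (rule has_field_derivative_subset[OF Fd im]) (rule subsetD[OF im imageI[OF t']])
      hence "(F \<circ> y has_real_derivative S (y t) * q t) (at t within {0..T})"
        by (rule DERIV_image_chain[OF _ y[OF t']])
      hence "(F \<circ> y has_real_derivative S (y t) * q t) (at t within {u..v})"
        by (rule has_field_derivative_subset) (use uv in auto)
      hence "((\<lambda>t. F (y t)) has_real_derivative G t) (at t within {u..v})"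
        by (simp add: G_def o_def mult.commute)
      thus "((\<lambda>t. F (y t)) has_vector_derivative G t) (at t within {u..v})"
        by (simp add: has_real_derivative_iff_has_vector_derivative)
    qed
    hence "\<tau> * (F (y v) - F (y u)) - integral {u..v} W = integral {u..v} (\<lambda>t. \<tau> * G t - W t)"
      using int[OF uv(1) uv(3)]
      by (subst integral_diff) (auto simp: integral_unique intro: integrable_on_mult_right)
    also have "\<dots> \<le> integral {u..v} (\<lambda>t. sinh H * V t)"
    proof (rule integral_le)
      show "(\<lambda>t. \<tau> * G t - W t) integrable_on {u..v}" "(\<lambda>t. sinh H * V t) integrable_on {u..v}"
        using int[OF uv(1) uv(3)] by (auto intro!: integrable_diff integrable_on_mult_right)
      show "\<tau> * G t - W t \<le> sinh H * V t" if "t \<in> {u..v}" for t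
        unfolding G_def W_def V_def S_def
        using comparison_pointwise[OF bound \<tau>, of t "q t" "p t"] that uv by simp
    qed
    finally show ?thesis by simp
  qed
  have split: "integral {0..T} X = integral {0..a} X + integral {a..b} X + integral {b..T} X"
    if "X integrable_on {0..T}" for X :: "real \<Rightarrow> real"
  proof -
    have "X integrable_on {0..b}" using that ab by (auto elim: integrable_subinterval_real)
    thus ?thesis
      using Henstock_Kurzweil_Integration.integral_combine[where a = 0 and c = b and b = T and f = X]
        Henstock_Kurzweil_Integration.integral_combine[where a = 0 and c = a and b = b and f = X] ab that by simp
  qed
  have \<sigma>2: "\<sigma>\<^sup>2 = 1" "(- \<sigma>)\<^sup>2 = 1" using \<sigma> by auto
  have "\<sigma> * (F (y b) - F (y a)) = pi * (cosh H - 1)"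
    using \<sigma> FH F0 ya yb by auto
  moreover have "sinh H * integral {0..T} V + integral {0..T} W \<ge> 2 * (\<sigma> * (F (y b) - F (y a)))"
    using piece[of 0 a "-\<sigma>"] piece[of a b \<sigma>] piece[of b T "-\<sigma>"] ab \<sigma>2 closed
    unfolding split[OF int(2)[OF order_refl order_refl]] split[OF int(3)[OF order_refl order_refl]]
    by (simp add: algebra_simps)
  ultimately show ?thesis by (simp add: V_def W_def)
qed

text \<open>In \<open>mercator_closed_curve_ordered\<close> either edge of the band may be met first; \<open>\<sigma>\<close> records
  which. Here the order of the two times is left open.\<close>

lemma mercator_closed_curve:
  fixes p q y :: "real \<Rightarrow> real" and T H a b :: real
  assumes y: "\<And>t. t \<in> {0..T} \<Longrightarrow> (y has_real_derivative q t) (at t within {0..T})"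
    and cp: "continuous_on {0..T} p" and cq: "continuous_on {0..T} q"
    and closed: "y T = y 0"
    and bound: "\<And>t. t \<in> {0..T} \<Longrightarrow> \<bar>y t\<bar> \<le> H"
    and a: "a \<in> {0..T}" "y a = - H" and b: "b \<in> {0..T}" "y b = H"
  shows "sinh H * integral {0..T} (\<lambda>t. sqrt ((p t)\<^sup>2 + (q t)\<^sup>2) / cosh (y t))
       \<ge> 2 * pi * (cosh H - 1) - integral {0..T} (\<lambda>t. p t * tanh (y t))"
proof -
  have H: "0 \<le> H" using bound[OF a(1)] by simp
  show ?thesis
  proof (cases "a \<le> b")
    case True thus ?thesis
      using a b by (intro mercator_closed_curve_ordered[OF y cp cq closed H bound, where a = a and b = b and \<sigma> = 1]) auto
  next
    case False thus ?thesis
      using a b by (intro mercator_closed_curve_ordered[OF y cp cq closed H bound, where a = b and b = a and \<sigma> = "-1"]) auto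
  qed
qed


section \<open>Area as a boundary integral\<close>

lemma continuous_on_polar:
  fixes g :: "complex \<Rightarrow> 'b::topological_space"
  assumes "continuous_on (ball 0 1) g" "r < 1"
  shows "continuous_on ({0..r} \<times> X) (\<lambda>(s, t). g (of_real s * cis t))"
proof -
  have "continuous_on ({0..r} \<times> X) (\<lambda>x. g (of_real (fst x) * cis (snd x)))"
    by (rule continuous_on_compose2[OF assms(1)])
       (use assms in \<open>auto intro!: continuous_intros simp: norm_mult\<close>)
  thus ?thesis by (simp add: case_prod_unfold)
qed

lemma cosh_real_ne0 [simp]: "cosh (x::real) \<noteq> 0"
  by (simp add: cosh_real_pos less_imp_neq[symmetric])

text \<open>The area form \<open>dx dy / (cosh y)\<^sup>2\<close> of the Mercator chart is the exterior derivative of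
  \<open>- tanh y dx\<close>, so this is Stokes' theorem on a disc. In polar coordinates the area density
  splits as \<open>\<partial>Q/\<partial>s + \<partial>P/\<partial>t\<close>. The second term integrates to \<open>0\<close> over a circle, because
  \<open>P\<close> is periodic, and the first is integrated in \<open>s\<close> after differentiating under the
  integral sign.\<close>

lemma green_mercator:
  fixes h :: "complex \<Rightarrow> complex" and r :: real
  assumes h: "h holomorphic_on ball 0 1" and r: "0 \<le> r" "r < 1"
  defines "z \<equiv> \<lambda>s t. complex_of_real s * cis t"
  shows "integral {0..r} (\<lambda>s. integral {0..2*pi} (\<lambda>t. s * (cmod (deriv h (z s t)) / cosh (Im (h (z s t))))\<^sup>2))
       = integral {0..2*pi} (\<lambda>t. r * (tanh (Im (h (z r t))) * Im (cis t * deriv h (z r t))))"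
proof -
  define h' where "h' = deriv h"
  define h'' where "h'' = deriv h'"
  have h': "h' holomorphic_on ball 0 1" and h'': "h'' holomorphic_on ball 0 1"
    unfolding h'_def h''_def by (auto intro!: holomorphic_deriv h)
  have cont: "continuous_on (ball 0 1) h" "continuous_on (ball 0 1) h'" "continuous_on (ball 0 1) h''"
    using h h' h'' by (auto intro: holomorphic_on_imp_continuous_on)
  have zb: "z s t \<in> ball 0 1" if "s \<in> {0..r}" for s t
    using that r by (auto simp: z_def norm_mult)
  have dh: "(h has_field_derivative h' (z s t)) (at (z s t))"
           "(h' has_field_derivative h'' (z s t)) (at (z s t))" if "s \<in> {0..r}" for s t
    using zb[OF that] h h' unfolding h'_def h''_def by (auto intro: holomorphic_derivI)
  define J where "J = (\<lambda>s t. Im (h (z s t)))"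
  define K where "K = (\<lambda>s t. cis t * h' (z s t))"
  define M where "M = (\<lambda>s t. (cis t)\<^sup>2 * h'' (z s t))"
  have zs: "((\<lambda>s. z s t) has_vector_derivative cis t) (at s within X)" for s t X
    unfolding z_def by (auto intro!: derivative_eq_intros simp: has_vector_derivative_complex_iff)
  have zt: "((\<lambda>t. z s t) has_vector_derivative \<i> * z s t) (at t within X)" for s t X
    unfolding z_def by (auto intro!: derivative_eq_intros simp: has_vector_derivative_complex_iff)
  have ct: "(cis has_vector_derivative \<i> * cis t) (at t within X)" for t X
    by (auto intro!: derivative_eq_intros simp: has_vector_derivative_complex_iff)
  have Im_d: "((\<lambda>x. Im (F x)) has_real_derivative Im D) (at x within X)"
    if "(F has_vector_derivative D) (at x within X)" for F D x X
    using that by (simp add: has_vector_derivative_complex_iff)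
  have Re_d: "((\<lambda>x. Re (F x)) has_real_derivative Re D) (at x within X)"
    if "(F has_vector_derivative D) (at x within X)" for F D x X
    using that by (simp add: has_vector_derivative_complex_iff)
  have hs: "((\<lambda>s. h (z s t)) has_vector_derivative K s t) (at s within X)"
    if "s \<in> {0..r}" for s t X
    using field_vector_diff_chain_within[OF zs has_field_derivative_at_within[OF dh(1)[OF that]]]
    by (simp add: o_def K_def)
  have ht: "((\<lambda>t. h (z s t)) has_vector_derivative \<i> * (of_real s * K s t)) (at t within X)"
    if "s \<in> {0..r}" for s t X
    using field_vector_diff_chain_within[OF zt has_field_derivative_at_within[OF dh(1)[OF that]]]
    by (simp add: o_def K_def z_def mult_ac)
  have Ks: "((\<lambda>s. K s t) has_vector_derivative M s t) (at s within X)"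
    if "s \<in> {0..r}" for s t X
    unfolding K_def
    using has_vector_derivative_mult_right[OF field_vector_diff_chain_within[OF zs has_field_derivative_at_within[OF dh(2)[OF that]]], where a = "cis t"]
    by (simp add: o_def M_def mult_ac power2_eq_square)
  have Kt: "((\<lambda>t. K s t) has_vector_derivative \<i> * (K s t + of_real s * M s t)) (at t within X)"
    if "s \<in> {0..r}" for s t X
    unfolding K_def
    using has_vector_derivative_mult[OF ct field_vector_diff_chain_within[OF zt has_field_derivative_at_within[OF dh(2)[OF that]]]]
    by (simp add: o_def M_def z_def mult_ac power2_eq_square distrib_left distrib_right add_ac)
  \<comment> \<open>The form \<open>- tanh y dx\<close> pulled back by \<open>h\<close> has the components \<open>-P\<close> along \<open>ds\<close>
    and \<open>Q\<close> along \<open>dt\<close>. The primed names are the derivatives of \<open>Q\<close> in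
    \<open>s\<close> and of \<open>P\<close> in \<open>t\<close>. The terms with second derivatives of \<open>h\<close> cancel in
    their sum.\<close>
  define Q where "Q = (\<lambda>s t. s * (tanh (J s t) * Im (K s t)))"
  define Q' where "Q' = (\<lambda>s t. tanh (J s t) * (Im (K s t) + s * Im (M s t)) + s * (1 - (tanh (J s t))\<^sup>2) * (Im (K s t))\<^sup>2)"
  define P where "P = (\<lambda>s t. tanh (J s t) * Re (K s t))"
  define P' where "P' = (\<lambda>s t. s * (1 - (tanh (J s t))\<^sup>2) * (Re (K s t))\<^sup>2 - tanh (J s t) * (Im (K s t) + s * Im (M s t)))"
  have Qd: "((\<lambda>s. Q s t) has_field_derivative Q' s t) (at s within X)" if "s \<in> {0..r}" for s t X
    unfolding Q_def J_def Q'_def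
    by (rule derivative_eq_intros Im_d[OF hs[OF that]] Im_d[OF Ks[OF that]] refl cosh_real_ne0)+
       (simp add: algebra_simps power2_eq_square)
  have Pd: "((\<lambda>t. P s t) has_field_derivative P' s t) (at t within X)" if "s \<in> {0..r}" for s t X
    unfolding P_def J_def P'_def
    by (rule derivative_eq_intros Im_d[OF ht[OF that]] Re_d[OF Kt[OF that]] refl cosh_real_ne0)+
       (simp add: algebra_simps power2_eq_square)
  have sumQP: "s * (cmod (deriv h (z s t)) / cosh (Im (h (z s t))))\<^sup>2 = Q' s t + P' s t" for s t
  proof -
    have "(cmod (K s t))\<^sup>2 = (Re (K s t))\<^sup>2 + (Im (K s t))\<^sup>2" by (rule cmod_power2)
    moreover have "cmod (K s t) = cmod (deriv h (z s t))" by (simp add: K_def h'_def norm_mult)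
    moreover have "1 - (tanh (J s t))^2 = 1 / (cosh (J s t))^2"
      by (simp add: tanh_def field_simps) (simp add: cosh_square_eq)
    moreover have "Q' s t + P' s t = s * (1 - (tanh (J s t))\<^sup>2) * ((Re (K s t))\<^sup>2 + (Im (K s t))\<^sup>2)"
      unfolding Q'_def P'_def by (simp add: algebra_simps)
    ultimately show ?thesis
      by (simp add: power_divide J_def)
  qed
  have cJ: "continuous_on ({0..r} \<times> X) (\<lambda>(s,t). J s t)"
     and cK: "continuous_on ({0..r} \<times> X) (\<lambda>(s,t). K s t)"
     and cM: "continuous_on ({0..r} \<times> X) (\<lambda>(s,t). M s t)" for X
    using cont[THEN continuous_on_polar, OF r(2), of X]
    unfolding J_def K_def M_def z_def case_prod_unfold by (auto intro!: continuous_intros)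
  have cQ': "continuous_on ({0..r} \<times> X) (\<lambda>(s,t). Q' s t)"
   and cP': "continuous_on ({0..r} \<times> X) (\<lambda>(s,t). P' s t)"
   and cQ: "continuous_on ({0..r} \<times> X) (\<lambda>(s,t). Q s t)" for X
    using cJ[of X] cK[of X] cM[of X] unfolding Q'_def P'_def Q_def case_prod_unfold
    by (auto intro!: continuous_intros)
  have iQ': "Q' s integrable_on {0..2*pi}" and iP': "P' s integrable_on {0..2*pi}"
   and iQ: "Q s integrable_on {0..2*pi}" if "s \<in> {0..r}" for s
  proof -
    have sub: "continuous_on {0..2*pi} (G s)" if G: "continuous_on ({0..r} \<times> {0..2*pi}) (\<lambda>(s,t). G s t)" for G :: "real \<Rightarrow> real \<Rightarrow> real"
    proof -
      have "continuous_on {0..2*pi} (\<lambda>t. case (s, t) of (s, t) \<Rightarrow> G s t)"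
        by (rule continuous_on_compose2[OF G]) (use \<open>s \<in> {0..r}\<close> in \<open>auto intro: continuous_on_Pair continuous_on_const continuous_on_id\<close>)
      thus ?thesis by simp
    qed
    show "Q' s integrable_on {0..2*pi}" "P' s integrable_on {0..2*pi}" "Q s integrable_on {0..2*pi}"
      by (intro integrable_continuous_interval sub cQ' cP' cQ)+
  qed
  have P0: "integral {0..2*pi} (P' s) = 0" if "s \<in> {0..r}" for s
  proof -
    have "(P' s has_integral P s (2*pi) - P s 0) {0..2*pi}"
      by (rule fundamental_theorem_of_calculus)
         (use Pd[OF that] in \<open>auto simp: has_real_derivative_iff_has_vector_derivative\<close>)
    moreover have "P s (2*pi) = P s 0" by (simp add: P_def J_def K_def z_def cis_2pi)
    ultimately show ?thesis by (simp add: integral_unique)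
  qed
  have "((\<lambda>s. integral {0..2*pi} (Q' s)) has_integral integral {0..2*pi} (Q r) - integral {0..2*pi} (Q 0)) {0..r}"
  proof (rule fundamental_theorem_of_calculus)
    fix s assume s: "s \<in> {0..r}"
    have "((\<lambda>s. integral (cbox 0 (2*pi)) (Q s)) has_field_derivative integral (cbox 0 (2*pi)) (Q' s)) (at s within {0..r})"
      by (rule leibniz_rule_field_derivative) (use s Qd iQ cQ' in auto)
    thus "((\<lambda>s. integral {0..2*pi} (Q s)) has_vector_derivative integral {0..2*pi} (Q' s)) (at s within {0..r})"
      by (simp add: has_real_derivative_iff_has_vector_derivative)
  qed (use r in auto)
  moreover have "integral {0..2*pi} (Q 0) = 0" by (simp add: Q_def)
  ultimately have "integral {0..r} (\<lambda>s. integral {0..2*pi} (Q' s)) = integral {0..2*pi} (Q r)"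
    by (simp add: integral_unique)
  moreover have "integral {0..2*pi} (\<lambda>t. Q' s t + P' s t) = integral {0..2*pi} (Q' s)" if "s \<in> {0..r}" for s
    using P0[OF that] by (subst integral_add) (use that iQ' iP' in auto)
  hence "integral {0..r} (\<lambda>s. integral {0..2*pi} (\<lambda>t. Q' s t + P' s t)) = integral {0..r} (\<lambda>s. integral {0..2*pi} (Q' s))"
    by (rule Henstock_Kurzweil_Integration.integral_cong)
  ultimately show ?thesis unfolding sumQP by (simp add: Q_def J_def K_def h'_def)
qed

text \<open>The linear form of the isoperimetric inequality: with \<open>sinh H = tan R\<close> it says that
  \<open>L sin R + (2 \<pi> - A) cos R \<ge> 2 \<pi>\<close> for length and area in the metric of curvature 1, where
  \<open>R\<close> is the spherical radius of the circle inscribed in the band.\<close>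

lemma mercator_inequality:
  fixes h :: "complex \<Rightarrow> complex" and r :: real
  assumes h: "h holomorphic_on ball 0 1" and r: "0 \<le> r" "r < 1"
  defines "z \<equiv> \<lambda>s t. complex_of_real s * cis t"
  assumes bound: "\<And>t. t \<in> {0..2*pi} \<Longrightarrow> \<bar>Im (h (z r t))\<bar> \<le> H"
    and a: "a \<in> {0..2*pi}" "Im (h (z r a)) = - H" and b: "b \<in> {0..2*pi}" "Im (h (z r b)) = H"
  defines "u \<equiv> \<lambda>s t. cmod (deriv h (z s t)) / cosh (Im (h (z s t)))"
  shows "sinh H * integral {0..2*pi} (\<lambda>t. r * u r t)
     \<ge> 2 * pi * (cosh H - 1) + integral {0..r} (\<lambda>s. integral {0..2*pi} (\<lambda>t. s * (u s t)\<^sup>2))"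
proof -
  define D where "D = (\<lambda>t. \<i> * (of_real r * (cis t * deriv h (z r t))))"
  have zb: "z r t \<in> ball 0 1" for t using r by (auto simp: z_def norm_mult)
  have dh: "(h has_field_derivative deriv h (z r t)) (at (z r t))" for t
    using holomorphic_derivI[OF h _ zb] by auto
  have zt: "((\<lambda>t. z r t) has_vector_derivative \<i> * z r t) (at t within X)" for t X
    unfolding z_def by (auto intro!: derivative_eq_intros simp: has_vector_derivative_complex_iff)
  have ht: "((\<lambda>t. h (z r t)) has_vector_derivative D t) (at t within X)" for t X
    using field_vector_diff_chain_within[OF zt has_field_derivative_at_within[OF dh]]
    by (simp add: o_def D_def z_def mult_ac)
  have "continuous_on (ball 0 1) (deriv h)"
    using h by (auto intro!: holomorphic_on_imp_continuous_on holomorphic_deriv)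
  hence "continuous_on {0..2*pi} (\<lambda>t. deriv h (z r t))"
    by (rule continuous_on_compose2) (use zb in \<open>auto intro!: continuous_intros simp: z_def\<close>)
  hence cD: "continuous_on {0..2*pi} D" unfolding D_def by (intro continuous_intros)
  have "sinh H * integral {0..2*pi} (\<lambda>t. sqrt ((Re (D t))\<^sup>2 + (Im (D t))\<^sup>2) / cosh (Im (h (z r t))))
       \<ge> 2 * pi * (cosh H - 1) - integral {0..2*pi} (\<lambda>t. Re (D t) * tanh (Im (h (z r t))))"
    by (rule mercator_closed_curve[OF _ _ _ _ bound a b])
       (use ht in \<open>auto intro!: continuous_intros cD simp: has_vector_derivative_complex_iff z_def cis_2pi\<close>)
  moreover have "sqrt ((Re (D t))\<^sup>2 + (Im (D t))\<^sup>2) / cosh (Im (h (z r t))) = r * u r t" for t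
    using r by (simp flip: cmod_def add: u_def) (simp add: D_def norm_mult)
  moreover have "Re (D t) * tanh (Im (h (z r t))) = - (r * (tanh (Im (h (z r t))) * Im (cis t * deriv h (z r t))))" for t
    by (simp add: D_def algebra_simps)
  moreover note green_mercator[OF h r]
  ultimately show ?thesis by (simp add: z_def u_def)
qed


section \<open>The Mercator chart of a map into the unit disc\<close>

text \<open>Both identities rest on \<open>|cos (\<zeta>/2)|\<^sup>2 + |sin (\<zeta>/2)|\<^sup>2 = cosh (Im \<zeta>)\<close> and its companion for
  \<open>sinh (Im \<zeta>)\<close>. Their quotient expresses the Mercator height of a point of the plane through a
  Cartesian coordinate of its stereographic image.\<close>

lemma mercator_tan:
  fixes \<zeta> :: complex
  assumes "cos (\<zeta> / 2) \<noteq> 0"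
  shows "1 + (cmod (tan (\<zeta> / 2)))\<^sup>2 = cosh (Im \<zeta>) / (cmod (cos (\<zeta> / 2)))\<^sup>2"
    and "2 * Im (tan (\<zeta> / 2)) = sinh (Im \<zeta>) / (cmod (cos (\<zeta> / 2)))\<^sup>2"
proof -
  define x y where "x = Re \<zeta> / 2" and "y = Im \<zeta> / 2"
  define s c where "s = sin (\<zeta> / 2)" and "c = cos (\<zeta> / 2)"
  have z2: "Re (\<zeta> / 2) = x" "Im (\<zeta> / 2) = y" by (auto simp: x_def y_def)
  have re: "Re s = sin x * cosh y" "Im s = cos x * sinh y" "Re c = cos x * cosh y" "Im c = - sin x * sinh y"
    unfolding s_def c_def by (auto simp: Re_sin Im_sin Re_cos Im_cos z2 cosh_def sinh_def field_simps simp del: Re_divide_numeral Im_divide_numeral)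
  have sc: "(sin x)^2 = 1 - (cos x)^2" "(cosh y)^2 = (sinh y)^2 + 1"
    by (simp_all add: sin_squared_eq cosh_square_eq)
  have d: "cosh (Im \<zeta>) = (cosh y)^2 + (sinh y)^2" "sinh (Im \<zeta>) = 2 * sinh y * cosh y"
    using cosh_double[of y] sinh_double[of y] by (simp_all add: y_def)
  have c0: "(cmod c)^2 \<noteq> 0" using assms by (simp add: c_def)
  have "(cmod c)^2 + (cmod s)^2 = cosh (Im \<zeta>)"
    unfolding cmod_power2 re d power_mult_distrib power2_minus using sc by algebra
  hence "cosh (Im \<zeta>) / (cmod c)^2 = 1 + (cmod s)^2 / (cmod c)^2"
    using c0 by (simp add: field_simps)
  thus "1 + (cmod (tan (\<zeta> / 2)))\<^sup>2 = cosh (Im \<zeta>) / (cmod (cos (\<zeta> / 2)))\<^sup>2"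
    by (simp add: tan_def s_def c_def norm_divide power_divide)
  have "2 * (Im s * Re c - Re s * Im c) = sinh (Im \<zeta>)"
    unfolding re d using sc by algebra
  hence "2 * ((Im s * Re c - Re s * Im c) / (cmod c)^2) = sinh (Im \<zeta>) / (cmod c)^2" by simp
  thus "2 * Im (tan (\<zeta> / 2)) = sinh (Im \<zeta>) / (cmod (cos (\<zeta> / 2)))\<^sup>2"
    by (simp add: tan_def Im_divide flip: s_def c_def cmod_power2)
qed

text \<open>The map \<open>\<zeta> \<mapsto> tan (\<zeta>/2)\<close> takes the strip \<open>|Re \<zeta>| < \<pi>/2\<close> onto the unit disc, and
  \<open>2 * Arctan\<close> inverts it. The last conclusion says that
  \<open>2 |dw| / (1 + |w|\<^sup>2)\<close> is the metric \<open>|d\<zeta>| / cosh (Im \<zeta>)\<close> in this chart.\<close>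

lemma mercator_chart:
  fixes g :: "complex \<Rightarrow> complex"
  assumes g: "g holomorphic_on S" "open S" and lt: "\<And>z. z \<in> S \<Longrightarrow> cmod (g z) < 1"
  obtains h where "h holomorphic_on S"
    and "\<And>z. z \<in> S \<Longrightarrow> tanh (Im (h z)) = 2 * Im (g z) / (1 + (cmod (g z))\<^sup>2)"
    and "\<And>z. z \<in> S \<Longrightarrow> cmod (deriv h z) / cosh (Im (h z)) = 2 * (cmod (deriv g z) / (1 + (cmod (g z))\<^sup>2))"
proof
  define h where "h = (\<lambda>z. 2 * Arctan (g z))"
  have im: "\<bar>Im (g z)\<bar> < 1" if "z \<in> S" for z
    using abs_Im_le_cmod[of "g z"] lt[OF that] by linarith
  have ne: "(g z)\<^sup>2 \<noteq> -1" if "z \<in> S" for z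
  proof
    assume "(g z)\<^sup>2 = -1"
    hence "(cmod (g z))^2 = 1" by (metis norm_minus_cancel norm_one norm_power)
    with lt[OF that] norm_ge_zero[of "g z"] show False by (auto simp: power2_eq_1_iff simp del: norm_ge_zero)
  qed
  show hol: "h holomorphic_on S" unfolding h_def
    using im holomorphic_on_compose_gen[OF g(1) holomorphic_on_Arctan[of "g ` S"]]
    by (auto intro!: holomorphic_intros simp: o_def)
  have t: "tan (h z / 2) = g z" if "z \<in> S" for z
    using tan_Arctan[OF ne[OF that]] by (simp add: h_def)
  have c: "cos (h z / 2) \<noteq> 0" if "z \<in> S" for z
  proof
    assume c0: "cos (h z / 2) = 0"
    \<comment> \<open>Division by zero gives \<open>tan\<close> the value \<open>0\<close> at a zero of \<open>cos\<close>.\<close>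
    hence "g z = 0" using t[OF that] by (simp add: tan_def)
    hence "h z = 0" by (simp add: h_def)
    with c0 show False by simp
  qed
  fix z assume z: "z \<in> S"
  have c2: "(cmod (cos (h z / 2)))^2 > 0" using c[OF z] by simp
  show "tanh (Im (h z)) = 2 * Im (g z) / (1 + (cmod (g z))\<^sup>2)"
    using mercator_tan[OF c[OF z]] c2 unfolding t[OF z] by (simp add: tanh_def)
  have hd: "(h has_field_derivative deriv h z) (at z)"
    using hol z g(2) by (auto intro: holomorphic_derivI)
  have "((\<lambda>z. tan (h z / 2)) has_field_derivative deriv h z / 2 / (cos (h z / 2))^2) (at z)"
    using c[OF z] by (auto intro!: derivative_eq_intros hd simp: divide_simps)
  hence "(g has_field_derivative deriv h z / 2 / (cos (h z / 2))^2) (at z)"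
    by (rule has_field_derivative_transform_within_open[where S = S]) (use z g t in auto)
  hence "deriv g z = deriv h z / 2 / (cos (h z / 2))^2" by (rule DERIV_imp_deriv)
  hence "cmod (deriv g z) = cmod (deriv h z) / 2 / (cmod (cos (h z / 2)))^2"
    by (simp add: norm_divide norm_power)
  thus "cmod (deriv h z) / cosh (Im (h z)) = 2 * (cmod (deriv g z) / (1 + (cmod (g z))\<^sup>2))"
    using mercator_tan(1)[OF c[OF z]] c2 unfolding t[OF z] by simp
qed


section \<open>The spherical isoperimetric inequality\<close>

text \<open>As a function of an arbitrary multiplier in place of \<open>cis \<beta>\<close> this is the support function of a
  bounded set. It is convex, and a finite convex function on the plane is continuous.\<close>

lemma continuous_on_Sup_linear:
  fixes k :: "real \<Rightarrow> complex"
  assumes k: "continuous_on {0..2*pi} k"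
  shows "continuous_on UNIV (\<lambda>\<beta>. SUP t\<in>{0..2*pi}. Im (cis \<beta> * k t))"
proof -
  have "bounded (k ` {0..2*pi})" using k by (intro compact_imp_bounded compact_continuous_image) auto
  then obtain B where B: "\<And>t. t \<in> {0..2*pi} \<Longrightarrow> cmod (k t) \<le> B" unfolding bounded_iff by blast
  define M where "M = (\<lambda>u. SUP t\<in>{0..2*pi}. Im (u * k t))"
  have bd: "bdd_above ((\<lambda>t. Im (u * k t)) ` {0..2*pi})" for u
  proof (intro bdd_aboveI2)
    fix t :: real assume "t \<in> {0..2*pi}"
    have "Im (u * k t) \<le> cmod (u * k t)" using abs_Im_le_cmod[of "u * k t"] by linarith
    also have "\<dots> \<le> cmod u * B" using B[OF \<open>t \<in> _\<close>] by (simp add: norm_mult mult_left_mono)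
    finally show "Im (u * k t) \<le> cmod u * B" .
  qed
  have "convex_on UNIV M"
  proof (rule convex_onI)
    fix s :: real and u v :: complex assume s: "0 < s" "s < 1"
    show "M ((1 - s) *\<^sub>R u + s *\<^sub>R v) \<le> (1 - s) * M u + s * M v"
      unfolding M_def
    proof (rule cSUP_least)
      fix t :: real assume t: "t \<in> {0..2*pi}"
      have "Im (((1 - s) *\<^sub>R u + s *\<^sub>R v) * k t) = (1 - s) * Im (u * k t) + s * Im (v * k t)"
        by (simp add: algebra_simps)
      also have "\<dots> \<le> (1 - s) * M u + s * M v"
        unfolding M_def using s t by (intro add_mono mult_left_mono cSUP_upper bd) auto
      finally show "Im (((1 - s) *\<^sub>R u + s *\<^sub>R v) * k t) \<le>
        (1 - s) * (SUP t\<in>{0..2*pi}. Im (u * k t)) + s * (SUP t\<in>{0..2*pi}. Im (v * k t))" by (simp add: M_def)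
    qed auto
  qed auto
  hence "continuous_on UNIV M" by (rule convex_on_continuous[OF open_UNIV])
  hence "continuous_on UNIV (\<lambda>\<beta>. M (cis \<beta>))"
    by (rule continuous_on_compose2) (auto intro!: continuous_intros)
  thus ?thesis by (simp add: M_def)
qed

text \<open>Turning by \<open>\<pi>\<close> exchanges the maximum of the heights with minus their minimum. The difference
  of the two therefore changes sign between \<open>\<beta> = 0\<close> and \<open>\<beta> = \<pi>\<close>, and it vanishes for
  some angle in between.\<close>

lemma balanced_direction:
  fixes k :: "real \<Rightarrow> complex"
  assumes k: "continuous_on {0..2*pi} k"
  obtains \<beta> a b where "a \<in> {0..2*pi}" "b \<in> {0..2*pi}" "Im (cis \<beta> * k a) = - Im (cis \<beta> * k b)"
    "\<And>t. t \<in> {0..2*pi} \<Longrightarrow> \<bar>Im (cis \<beta> * k t)\<bar> \<le> Im (cis \<beta> * k b)"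
proof -
  define M where "M = (\<lambda>\<beta>. SUP t\<in>{0..2*pi}. Im (cis \<beta> * k t))"
  have cM: "continuous_on UNIV M" unfolding M_def by (rule continuous_on_Sup_linear[OF k])
  have att: "\<exists>t\<in>{0..2*pi}. M \<beta> = Im (cis \<beta> * k t) \<and> (\<forall>s\<in>{0..2*pi}. Im (cis \<beta> * k s) \<le> Im (cis \<beta> * k t))" for \<beta>
  proof -
    have "continuous_on {0..2*pi} (\<lambda>t. Im (cis \<beta> * k t))" using k by (intro continuous_intros)
    then obtain t where t: "t \<in> {0..2*pi}" "\<forall>s\<in>{0..2*pi}. Im (cis \<beta> * k s) \<le> Im (cis \<beta> * k t)"
      using continuous_attains_sup[of "{0..2*pi}" "\<lambda>t. Im (cis \<beta> * k t)"] by (metis atLeastatMost_empty_iff compact_Icc mult_nonneg_nonneg pi_ge_zero zero_le_numeral)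
    have "M \<beta> = Im (cis \<beta> * k t)" unfolding M_def using t by (intro cSup_eq_maximum) auto
    thus ?thesis using t by blast
  qed
  define N where "N = (\<lambda>\<beta>. M \<beta> - M (\<beta> + pi))"
  have cN: "continuous_on UNIV N" unfolding N_def
    by (intro continuous_intros cM continuous_on_compose2[OF cM]) auto
  have "N pi = - N 0" by (simp add: N_def M_def cis_2pi flip: mult_2)
  hence "\<exists>\<beta>. 0 \<le> \<beta> \<and> \<beta> \<le> pi \<and> N \<beta> = 0"
    using IVT'[of N 0 0 pi] IVT2'[of N pi 0 0] continuous_on_subset[OF cN subset_UNIV]
    by (cases "N 0 \<le> 0") auto
  then obtain \<beta> where \<beta>: "M \<beta> = M (\<beta> + pi)" by (auto simp: N_def)
  have neg: "cis (\<beta> + pi) = - cis \<beta>" by (simp add: cis_mult[symmetric])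
  obtain b where b: "b \<in> {0..2*pi}" "M \<beta> = Im (cis \<beta> * k b)" "\<forall>s\<in>{0..2*pi}. Im (cis \<beta> * k s) \<le> Im (cis \<beta> * k b)"
    using att by blast
  obtain a where a: "a \<in> {0..2*pi}" "M (\<beta> + pi) = - Im (cis \<beta> * k a)" "\<forall>s\<in>{0..2*pi}. - Im (cis \<beta> * k s) \<le> - Im (cis \<beta> * k a)"
    using att[of "\<beta> + pi"] unfolding neg by auto
  show ?thesis
  proof (rule that[OF a(1) b(1)])
    show "Im (cis \<beta> * k a) = - Im (cis \<beta> * k b)" using a b \<beta> by simp
    fix t assume "t \<in> {0..2*pi}"
    thus "\<bar>Im (cis \<beta> * k t)\<bar> \<le> Im (cis \<beta> * k b)"
      using a(3) b(3) a(2) b(2) \<beta> by (force simp: abs_le_iff)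
  qed
qed

text \<open>The spherical derivative of a map with values in the plane, free of the case distinction at
  poles.\<close>

definition sharp :: "(complex \<Rightarrow> complex) \<Rightarrow> complex \<Rightarrow> real" where
  "sharp g z = cmod (deriv g z) / (1 + (cmod (g z))\<^sup>2)"

lemma one_plus_norm_sq_ne0: "1 + (cmod w)\<^sup>2 \<noteq> 0"
  by (metis add_nonneg_eq_0_iff zero_le_one zero_le_power2 zero_neq_one)

lemma continuous_on_sharp:
  assumes "g holomorphic_on S" "open S" shows "continuous_on S (sharp g)"
  unfolding sharp_def using assms one_plus_norm_sq_ne0
  by (auto intro!: continuous_intros holomorphic_on_imp_continuous_on holomorphic_deriv)

text \<open>A rotation about \<open>0\<close> changes neither side, so \<open>balanced_direction\<close> applies to
  the stereographic coordinates of the curve and brings \<open>mercator_inequality\<close> into play, with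
  \<open>2 * L\<close> and \<open>4 * A\<close> as length and area for the metric of curvature 1. The first conclusion
  follows by Cauchy--Schwarz applied to \<open>(sinh H, 1)\<close> and \<open>(2 * L, 2 * pi - 4 * A)\<close>. The
  second covers images larger than a hemisphere, for which the first gives no useful lower bound
  on the length.\<close>

lemma isoperimetric:
  fixes g :: "complex \<Rightarrow> complex"
  assumes g: "g holomorphic_on ball 0 1" and lt: "\<And>z. z \<in> ball 0 1 \<Longrightarrow> cmod (g z) < 1" and r: "0 \<le> r" "r < 1"
  defines "u \<equiv> \<lambda>s t. sharp g (complex_of_real s * cis t)"
  defines "L \<equiv> integral {0..2*pi} (\<lambda>t. r * u r t)"
  defines "A \<equiv> integral {0..r} (\<lambda>s. integral {0..2*pi} (\<lambda>t. s * (u s t)\<^sup>2))"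
  shows "L\<^sup>2 \<ge> 4 * A * (pi - A)" and "A \<ge> pi / 2 \<Longrightarrow> L \<ge> pi"
proof -
  define z where "z = (\<lambda>s t. complex_of_real s * cis t)"
  have zb: "z s t \<in> ball 0 1" if "s \<in> {0..r}" for s t using that r by (auto simp: z_def norm_mult)
  have zr: "z r t \<in> ball 0 1" for t using zb r by auto
  have "continuous_on {0..2*pi} (\<lambda>t. g (z r t))"
    by (rule continuous_on_compose2[OF holomorphic_on_imp_continuous_on[OF g]])
       (use zr in \<open>auto simp: z_def intro!: continuous_intros\<close>)
  hence "continuous_on {0..2*pi} (\<lambda>t. (2 / (1 + (cmod (g (z r t)))\<^sup>2)) *\<^sub>R g (z r t))"
    using one_plus_norm_sq_ne0 by (intro continuous_intros) auto
  then obtain \<beta> a b where ab: "a \<in> {0..2*pi}" "b \<in> {0..2*pi}" and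
    "Im (cis \<beta> * ((2 / (1 + (cmod (g (z r a)))\<^sup>2)) *\<^sub>R g (z r a))) = - Im (cis \<beta> * ((2 / (1 + (cmod (g (z r b)))\<^sup>2)) *\<^sub>R g (z r b)))"
    "\<And>t. t \<in> {0..2*pi} \<Longrightarrow> \<bar>Im (cis \<beta> * ((2 / (1 + (cmod (g (z r t)))\<^sup>2)) *\<^sub>R g (z r t)))\<bar> \<le>
       Im (cis \<beta> * ((2 / (1 + (cmod (g (z r b)))\<^sup>2)) *\<^sub>R g (z r b)))"
    by (rule balanced_direction) blast
  note bal = this(3,4)
  define G where "G = (\<lambda>z. cis \<beta> * g z)"
  have G: "G holomorphic_on ball 0 1" "\<And>z. z \<in> ball 0 1 \<Longrightarrow> cmod (G z) < 1"
    using g lt by (auto simp: G_def norm_mult intro!: holomorphic_intros)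
  have sG: "cmod (deriv G z) / (1 + (cmod (G z))\<^sup>2) = sharp g z" if "z \<in> ball 0 1" for z
  proof -
    have "deriv G z = cis \<beta> * deriv g z" unfolding G_def
      using g that by (intro deriv_cmult) (auto simp: holomorphic_on_imp_differentiable_at)
    thus ?thesis by (simp add: sharp_def G_def norm_mult)
  qed
  obtain h where h: "h holomorphic_on ball 0 1"
    and tanh: "\<And>z. z \<in> ball 0 1 \<Longrightarrow> tanh (Im (h z)) = 2 * Im (G z) / (1 + (cmod (G z))\<^sup>2)"
    and dh: "\<And>z. z \<in> ball 0 1 \<Longrightarrow> cmod (deriv h z) / cosh (Im (h z)) = 2 * (cmod (deriv G z) / (1 + (cmod (G z))\<^sup>2))"
    using mercator_chart[OF G(1) open_ball G(2)] by metis
  have tanh': "tanh (Im (h (z r t))) = Im (cis \<beta> * ((2 / (1 + (cmod (g (z r t)))\<^sup>2)) *\<^sub>R g (z r t)))" for t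
    unfolding tanh[OF zr] by (simp add: G_def norm_mult)
  have dh': "cmod (deriv h (z s t)) / cosh (Im (h (z s t))) = 2 * u s t" if "s \<in> {0..r}" for s t
    using dh[OF zb[OF that]] sG[OF zb[OF that]] by (simp only: u_def z_def)
  define H where "H = Im (h (z r b))"
  have a: "Im (h (z r a)) = - H"
  proof -
    have "tanh (Im (h (z r a))) = tanh (- H)" using bal(1) tanh' by (simp add: H_def)
    thus ?thesis by (simp only: tanh_real_eq_iff)
  qed
  have bound: "\<bar>Im (h (z r t))\<bar> \<le> H" if "t \<in> {0..2*pi}" for t
  proof -
    have "tanh \<bar>Im (h (z r t))\<bar> \<le> tanh H"
      using bal(2)[OF that] unfolding H_def tanh'[symmetric] by simp
    thus ?thesis by (simp only: tanh_real_le_iff)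
  qed
  have "sinh H * integral {0..2*pi} (\<lambda>t. r * (cmod (deriv h (z r t)) / cosh (Im (h (z r t)))))
     \<ge> 2 * pi * (cosh H - 1) + integral {0..r} (\<lambda>s. integral {0..2*pi} (\<lambda>t. s * (cmod (deriv h (z s t)) / cosh (Im (h (z s t))))\<^sup>2))"
    unfolding z_def by (rule mercator_inequality[OF h r _ ab(1) _ ab(2)]) (use a bound in \<open>auto simp: H_def z_def\<close>)
  also have "integral {0..2*pi} (\<lambda>t. r * (cmod (deriv h (z r t)) / cosh (Im (h (z r t))))) = integral {0..2*pi} (\<lambda>t. 2 * (r * u r t))"
    using dh'[of r] r by simp
  also have "\<dots> = 2 * L" by (simp add: L_def)
  also have "integral {0..r} (\<lambda>s. integral {0..2*pi} (\<lambda>t. s * (cmod (deriv h (z s t)) / cosh (Im (h (z s t))))\<^sup>2)) =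
             integral {0..r} (\<lambda>s. integral {0..2*pi} (\<lambda>t. 4 * (s * (u s t)\<^sup>2)))"
    using dh' by (intro Henstock_Kurzweil_Integration.integral_cong) (simp add: power2_eq_square mult_ac)
  also have "\<dots> = 4 * A" by (simp add: A_def)
  finally have main: "2 * pi * (cosh H - 1) + 4 * A \<le> sinh H * (2 * L)" .
  have H: "0 \<le> H" using bound[OF ab(1)] by linarith
  have ch: "1 \<le> cosh H" "(cosh H)^2 = (sinh H)^2 + 1" "0 \<le> sinh H" "sinh H < cosh H"
    using H by (simp_all add: cosh_square_eq cosh_real_ge_1 sinh_less_cosh_real)
  show "L \<ge> pi" if "A \<ge> pi / 2"
  proof (rule ccontr)
    assume "\<not> L \<ge> pi"
    hence "sinh H * (2 * L) \<le> sinh H * (2 * pi)" using ch by (intro mult_left_mono) auto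
    also have "\<dots> < cosh H * (2 * pi)" using ch by simp
    finally show False using main that by (simp add: algebra_simps)
  qed
  have "(2 * pi * cosh H)^2 \<le> (sinh H * (2 * L) + (2 * pi - 4 * A))^2"
    using main ch by (intro power_mono) (auto simp: algebra_simps)
  also have "\<dots> \<le> ((sinh H)^2 + 1) * ((2 * L)^2 + (2 * pi - 4 * A)^2)"
    using zero_le_power2[of "sinh H * (2 * pi - 4 * A) - 2 * L"] by (simp add: power2_eq_square algebra_simps)
  finally have "(cosh H)^2 * (2 * pi)^2 \<le> (cosh H)^2 * ((2 * L)^2 + (2 * pi - 4 * A)^2)"
    using ch(2) by (simp add: power_mult_distrib mult.commute)
  hence "(2 * pi)^2 \<le> (2 * L)^2 + (2 * pi - 4 * A)^2" by simp
  thus "L\<^sup>2 \<ge> 4 * A * (pi - A)" by (simp add: power2_eq_square algebra_simps)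
qed


section \<open>From the isoperimetric inequality to the length bound\<close>

text \<open>The variance of \<open>u\<close> about its mean value \<open>m\<close> is nonnegative.\<close>

lemma cauchy_schwarz_interval:
  fixes u :: "real \<Rightarrow> real"
  assumes u: "continuous_on {0..T} u" and T: "0 < T"
  shows "(integral {0..T} u)\<^sup>2 \<le> T * integral {0..T} (\<lambda>t. (u t)\<^sup>2)"
proof -
  define m where "m = integral {0..T} u / T"
  have int: "u integrable_on {0..T}" "(\<lambda>t. (u t)\<^sup>2) integrable_on {0..T}"
    using u by (auto intro!: integrable_continuous_interval continuous_intros)
  have I: "((\<lambda>t. (u t)\<^sup>2 - (2 * m) * u t + m\<^sup>2) has_integral
          integral {0..T} (\<lambda>t. (u t)\<^sup>2) - (2 * m) * integral {0..T} u + T * m\<^sup>2) {0..T}"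
    using int T has_integral_const_real[of "m\<^sup>2" 0 T]
    by (intro has_integral_add has_integral_diff has_integral_mult_right integrable_integral) auto
  have "0 \<le> (u t)\<^sup>2 - (2 * m) * u t + m\<^sup>2" for t
    using zero_le_power2[of "u t - m"] by (simp add: power2_diff mult_ac)
  hence "0 \<le> integral {0..T} (\<lambda>t. (u t)\<^sup>2) - (2 * m) * integral {0..T} u + T * m\<^sup>2"
    by (rule has_integral_nonneg[OF I])
  also have "\<dots> = integral {0..T} (\<lambda>t. (u t)\<^sup>2) - (integral {0..T} u)\<^sup>2 / T"
    using T by (simp add: m_def power2_eq_square field_simps)
  finally show ?thesis using T by (simp add: field_simps)
qed

text \<open>With \<open>A s\<close> the area of the image of the disc of radius \<open>s\<close>, the fact \<open>growth\<close> is the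
  differential inequality that combines \<open>isoperimetric\<close> with Cauchy--Schwarz. It makes
  \<open>D s = A s / ((pi - A s) * s\<^sup>2)\<close> nondecreasing as long as the area stays below that of a
  hemisphere. For the rotations \<open>z \<mapsto> \<eta> z\<close> this quotient is constant, which is why the
  resulting bound is sharp.\<close>

lemma circle_length_lower_bound:
  fixes g :: "complex \<Rightarrow> complex"
  assumes g: "g holomorphic_on ball 0 1" and lt: "\<And>z. z \<in> ball 0 1 \<Longrightarrow> cmod (g z) < 1" and r: "0 < r" "r < 1"
  defines "u \<equiv> \<lambda>s t. sharp g (complex_of_real s * cis t)"
  shows "integral {0..2*pi} (\<lambda>t. r * u r t) \<ge> 2 * pi * r * sharp g 0 / (1 + r\<^sup>2 * (sharp g 0)\<^sup>2)"
proof -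
  define \<alpha> where "\<alpha> = sharp g 0"
  define \<rho> where "\<rho> = r * \<alpha>"
  have sharp0: "sharp g z \<ge> 0" for z by (simp add: sharp_def)
  have \<rho>: "0 \<le> \<rho>" using r sharp0 by (simp add: \<rho>_def \<alpha>_def)
  define M where "M = (\<lambda>s. integral {0..2*pi} (\<lambda>t. (u s t)\<^sup>2))"
  define L where "L = (\<lambda>s. integral {0..2*pi} (\<lambda>t. s * u s t))"
  define A where "A = (\<lambda>s. integral {0..s} (\<lambda>s. s * M s))"
  have cu2: "continuous_on ({0..r} \<times> X) (\<lambda>(s, t). u s t)" for X
    unfolding u_def by (rule continuous_on_polar[OF continuous_on_sharp[OF g open_ball] r(2)])
  have cu: "continuous_on {0..2*pi} (u s)" if "s \<in> {0..r}" for s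
  proof -
    have "continuous_on {0..2*pi} (\<lambda>t. case (s, t) of (s, t) \<Rightarrow> u s t)"
      by (rule continuous_on_compose2[OF cu2[of "{0..2*pi}"]])
         (use that in \<open>auto intro: continuous_on_Pair continuous_on_const continuous_on_id\<close>)
    thus ?thesis by simp
  qed
  have cM: "continuous_on {0..r} M"
  proof -
    have "continuous_on {0..r} (\<lambda>s. integral (cbox 0 (2*pi)) (\<lambda>t. (u s t)\<^sup>2))"
      by (rule integral_continuous_on_param)
         (use cu2[of "cbox 0 (2*pi)"] in \<open>auto simp: case_prod_unfold intro!: continuous_intros\<close>)
    thus ?thesis by (simp add: M_def)
  qed
  have M0: "M s \<ge> 0" if "s \<in> {0..r}" for s
    unfolding M_def by (intro integral_nonneg integrable_continuous_interval continuous_intros cu that) auto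
  have csM: "continuous_on {0..r} (\<lambda>s. s * M s)" by (intro continuous_intros cM)
  have Ad: "(A has_real_derivative s * M s) (at s within {0..r})" if "s \<in> {0..r}" for s
    unfolding A_def using integral_has_real_derivative[OF csM that] .
  have isM: "(\<lambda>s. s * M s) integrable_on {0..s}" if "s \<in> {0..r}" for s
    using that by (intro integrable_continuous_interval continuous_on_subset[OF csM]) auto
  have A0: "0 \<le> A s" "A s \<le> A r" if "s \<in> {0..r}" for s
    unfolding A_def using that M0 isM[OF that] isM[of r] r
    by (auto intro!: integral_nonneg integral_subset_le)
  have iso: "(L s)\<^sup>2 \<ge> 4 * A s * (pi - A s)" "A s \<ge> pi / 2 \<Longrightarrow> L s \<ge> pi" if "s \<in> {0..r}" for s
    using isoperimetric[OF g lt, of s] that r unfolding L_def A_def M_def u_def by auto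
  have L0: "L r \<ge> 0" unfolding L_def
    using r cu sharp0 by (intro integral_nonneg integrable_continuous_interval continuous_intros cu) (auto simp: u_def)
  have growth: "s * (s * M s) \<ge> 2 * A s * (pi - A s) / pi" if "s \<in> {0..r}" for s
  proof -
    have "4 * A s * (pi - A s) \<le> (s * integral {0..2*pi} (u s))\<^sup>2"
      using iso(1)[OF that] by (simp add: L_def)
    also have "\<dots> \<le> s\<^sup>2 * (2 * pi * M s)"
      unfolding M_def power_mult_distrib by (intro mult_left_mono cauchy_schwarz_interval cu that) auto
    finally show ?thesis by (simp add: field_simps power2_eq_square)
  qed
  have target: "2 * \<rho> / (1 + \<rho>\<^sup>2) \<le> 1"
    using zero_le_power2[of "1 - \<rho>"] one_plus_norm_sq_ne0[of "of_real \<rho>"]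
    by (subst divide_le_eq_1_pos) (auto simp: power2_eq_square algebra_simps intro: add_pos_nonneg)
  have "2 * pi * \<rho> / (1 + \<rho>\<^sup>2) \<le> L r"
  proof (cases "A r \<ge> pi / 2")
    case True
    hence "pi \<le> L r" using iso r by auto
    moreover have "pi * (2 * \<rho> / (1 + \<rho>\<^sup>2)) \<le> pi * 1" using target by (intro mult_left_mono) auto
    ultimately show ?thesis by (simp add: mult_ac)
  next
    case False
    hence Alt: "A s < pi / 2" if "s \<in> {0..r}" for s using A0(2)[OF that] by simp
    define D where "D = (\<lambda>s. A s / ((pi - A s) * s\<^sup>2))"
    have Dmono: "D s \<le> D r" if s: "0 < s" "s < r" for s
    proof (rule DERIV_nonneg_imp_increasing_open[of s r D])
      show "s \<le> r" using s by simp
      have cA: "continuous_on {0..r} A" using Ad by (rule DERIV_continuous_on)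
      show "continuous_on {s..r} D" unfolding D_def
      proof (intro continuous_intros continuous_on_subset[OF cA])
        show "\<forall>x\<in>{s..r}. (pi - A x) * x\<^sup>2 \<noteq> 0"
        proof
          fix x assume "x \<in> {s..r}"
          thus "(pi - A x) * x\<^sup>2 \<noteq> 0" using Alt[of x] s pi_gt_zero by auto
        qed
      qed (use s in auto)
      fix x assume x: "s < x" "x < r"
      hence x': "x \<in> {0..r}" "0 < x" using s by auto
      have Adx: "(A has_real_derivative x * M x) (at x)"
        using Ad[OF x'(1)] x s by (simp add: at_within_Icc_at)
      have pA: "pi - A x > 0" using Alt[OF x'(1)] pi_gt_zero by linarith
      define E where "E = ((x * M x) * ((pi - A x) * x\<^sup>2) - A x * ((0 - x * M x) * x\<^sup>2 + (2 * x) * (pi - A x))) / (((pi - A x) * x\<^sup>2) * ((pi - A x) * x\<^sup>2))"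
      have "(D has_real_derivative E) (at x)" unfolding D_def E_def
        using pA x' by (auto intro!: derivative_eq_intros Adx simp: power2_eq_square)
      moreover have "E \<ge> 0"
      proof -
        have "(x * M x) * ((pi - A x) * x\<^sup>2) - A x * ((0 - x * M x) * x\<^sup>2 + (2 * x) * (pi - A x))
          = x * pi * (x * (x * M x) - 2 * A x * (pi - A x) / pi)"
          by (simp add: power2_eq_square field_simps)
        also have "\<dots> \<ge> 0" using growth[OF x'(1)] x' by (intro mult_nonneg_nonneg) auto
        finally show ?thesis unfolding E_def by (rule divide_nonneg_nonneg) simp
      qed
      ultimately show "\<exists>y. (D has_real_derivative y) (at x) \<and> 0 \<le> y" by blast
    qed
    \<comment> \<open>Near \<open>0\<close> the density \<open>M\<close> is close to \<open>2 * pi * \<alpha>\<^sup>2\<close>; integrating this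
      bounds \<open>D\<close> from below at small radii.\<close>
    have "\<alpha>\<^sup>2 \<le> D r + e" if e: "e > 0" for e
    proof -
      have "M 0 = 2 * pi * \<alpha>\<^sup>2" by (simp add: M_def u_def \<alpha>_def)
      moreover obtain d where d: "d > 0" "\<And>s. s \<in> {0..r} \<Longrightarrow> dist s 0 < d \<Longrightarrow> dist (M s) (M 0) < 2 * pi * e"
        using cM r e unfolding continuous_on_iff by (metis atLeastAtMost_iff less_imp_le mult_pos_pos order_refl pi_gt_zero zero_less_numeral)
      ultimately have Mge: "M s \<ge> 2 * pi * \<alpha>\<^sup>2 - 2 * pi * e" if "s \<in> {0..r}" "s < d" for s
      proof -
        have "\<bar>M s - M 0\<bar> < 2 * pi * e" using d(2)[of s] that by (auto simp: dist_real_def)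
        with \<open>M 0 = _\<close> show ?thesis by linarith
      qed
      define s where "s = min d r / 2"
      have s: "0 < s" "s < r" "s < d" using d r by (auto simp: s_def min_def)
      have "((\<lambda>x. x * (2 * pi * \<alpha>\<^sup>2 - 2 * pi * e)) has_integral s\<^sup>2 / 2 * (2 * pi * \<alpha>\<^sup>2 - 2 * pi * e) - 0\<^sup>2 / 2 * (2 * pi * \<alpha>\<^sup>2 - 2 * pi * e)) {0..s}"
        by (rule fundamental_theorem_of_calculus)
           (use s in \<open>auto simp flip: has_real_derivative_iff_has_vector_derivative intro!: derivative_eq_intros\<close>)
      hence "s\<^sup>2 / 2 * (2 * pi * \<alpha>\<^sup>2 - 2 * pi * e) \<le> A s"
        unfolding A_def using Mge isM[of s] s
        by (intro has_integral_le[OF _ integrable_integral]) (auto intro: mult_left_mono)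
      hence "\<alpha>\<^sup>2 - e \<le> A s / (pi * s\<^sup>2)" using s by (simp add: field_simps)
      also have "\<dots> \<le> D s" unfolding D_def
        using s A0[of s] Alt[of s] pi_gt_zero by (intro divide_left_mono mult_right_mono) auto
      also have "\<dots> \<le> D r" using Dmono s by simp
      finally show ?thesis by simp
    qed
    hence "\<alpha>\<^sup>2 \<le> D r" by (rule field_le_epsilon)
    moreover have pA: "pi - A r > 0" using False pi_gt_zero by linarith
    ultimately have "\<rho>\<^sup>2 * (pi - A r) \<le> A r"
      using r by (simp add: D_def \<rho>_def field_simps power_mult_distrib)
    define a where "a = pi * \<rho>\<^sup>2 / (1 + \<rho>\<^sup>2)"
    have p1: "1 + \<rho>\<^sup>2 > 0" by (simp add: add_pos_nonneg)
    have a: "a \<le> A r" using \<open>\<rho>\<^sup>2 * (pi - A r) \<le> A r\<close> p1 unfolding a_def by (simp add: field_simps)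
    have pa: "pi - a = pi / (1 + \<rho>\<^sup>2)" using p1 by (simp add: a_def field_simps)
    \<comment> \<open>The function \<open>x \<mapsto> 4 * x * (pi - x)\<close> increases up to \<open>pi / 2\<close>, and both \<open>a\<close>
      and \<open>A r\<close> lie there.\<close>
    have "(2 * pi * \<rho> / (1 + \<rho>\<^sup>2))\<^sup>2 = 4 * a * (pi - a)"
      unfolding pa by (simp add: a_def power2_eq_square field_simps)
    also have "\<dots> \<le> 4 * A r * (pi - A r)"
      using mult_nonneg_nonneg[of "A r - a" "pi - A r - a"] a False by (simp add: algebra_simps)
    also have "\<dots> \<le> (L r)\<^sup>2" using iso(1)[of r] r by simp
    finally show ?thesis by (rule power2_le_imp_le[OF _ L0])
  qed
  thus ?thesis by (simp add: L_def \<rho>_def \<alpha>_def power_mult_distrib mult_ac)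
qed


section \<open>Rotations and the spherical derivative\<close>

text \<open>Up to a positive factor the matrix with rows \<open>(a, b)\<close> and \<open>(c, d)\<close> is unitary: its
  columns are nonzero, orthogonal and of equal length. These are the Moebius transformations that
  act on the sphere as rotations.\<close>

definition unitary_coeffs :: "complex \<Rightarrow> complex \<Rightarrow> complex \<Rightarrow> complex \<Rightarrow> bool" where
  "unitary_coeffs a b c d \<longleftrightarrow> (a \<noteq> 0 \<or> c \<noteq> 0) \<and> (cmod a)\<^sup>2 + (cmod c)\<^sup>2 = (cmod b)\<^sup>2 + (cmod d)\<^sup>2
     \<and> a * cnj b + c * cnj d = 0"

text \<open>A multiple of a unitary matrix scales the Hermitian norm of \<open>(w, 1)\<close> and has a determinant of
  the corresponding modulus. The latter is Lagrange's identity for the two columns.\<close>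

lemma unitary_coeffs_norms:
  assumes "unitary_coeffs a b c d"
  defines "N \<equiv> (cmod a)\<^sup>2 + (cmod c)\<^sup>2"
  shows "N > 0" and "(cmod (a * w + b))\<^sup>2 + (cmod (c * w + d))\<^sup>2 = N * (1 + (cmod w)\<^sup>2)"
    and "cmod (a * d - b * c) = N"
proof -
  have N2: "N = (cmod b)\<^sup>2 + (cmod d)\<^sup>2" and ne: "a \<noteq> 0 \<or> c \<noteq> 0" and orth: "a * cnj b + c * cnj d = 0"
    using assms by (auto simp: unitary_coeffs_def)
  show N: "N > 0" using ne by (auto simp: N_def add_pos_nonneg add_nonneg_pos)
  have orth': "cnj a * b + cnj c * d = 0" using arg_cong[OF orth, of cnj] by simp
  have cN: "of_real N = a * cnj a + c * cnj c" "of_real N = b * cnj b + d * cnj d"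
    by (subst N_def N2, simp flip: complex_norm_square)+
  have "complex_of_real ((cmod (a * w + b))\<^sup>2 + (cmod (c * w + d))\<^sup>2) =
      (a * w + b) * cnj (a * w + b) + (c * w + d) * cnj (c * w + d)"
    by (simp only: of_real_add complex_norm_square)
  also have "\<dots> = (a * cnj a + c * cnj c) * (w * cnj w) + (b * cnj b + d * cnj d)
      + (a * cnj b + c * cnj d) * w + (cnj a * b + cnj c * d) * cnj w"
    by (simp add: algebra_simps)
  also have "\<dots> = of_real (N * (1 + (cmod w)\<^sup>2))"
    unfolding orth orth' cN[symmetric] unfolding complex_norm_square[symmetric] by (simp add: algebra_simps)
  finally show "(cmod (a * w + b))\<^sup>2 + (cmod (c * w + d))\<^sup>2 = N * (1 + (cmod w)\<^sup>2)"
    by (simp only: of_real_eq_iff)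
  have "complex_of_real ((cmod (a * d - b * c))\<^sup>2) = (a * d - b * c) * cnj (a * d - b * c)"
    by (simp only: complex_norm_square)
  also have "\<dots> = (a * cnj a + c * cnj c) * (b * cnj b + d * cnj d) - (a * cnj b + c * cnj d) * (cnj a * b + cnj c * d)"
    by (simp add: algebra_simps)
  also have "\<dots> = of_real (N\<^sup>2)"
    unfolding orth cN[symmetric] by (simp add: power2_eq_square)
  finally have "(cmod (a * d - b * c))\<^sup>2 = N\<^sup>2" by (simp only: of_real_eq_iff)
  thus "cmod (a * d - b * c) = N" using N by (simp add: power2_eq_iff_nonneg)
qed

lemma sharp_unitary:
  assumes u: "unitary_coeffs a b c d" and g: "g field_differentiable at z" and nz: "c * g z + d \<noteq> 0"
  shows "sharp (\<lambda>z. (a * g z + b) / (c * g z + d)) z = sharp g z"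
proof -
  define N where "N = (cmod a)\<^sup>2 + (cmod c)\<^sup>2"
  note N = unitary_coeffs_norms[OF u, folded N_def]
  have gd: "(g has_field_derivative deriv g z) (at z)" using g by (simp add: field_differentiable_derivI)
  have "((\<lambda>z. (a * g z + b) / (c * g z + d)) has_field_derivative
     (a * d - b * c) * deriv g z / (c * g z + d)\<^sup>2) (at z)"
    using nz by (auto intro!: derivative_eq_intros gd simp: power2_eq_square algebra_simps)
  hence "deriv (\<lambda>z. (a * g z + b) / (c * g z + d)) z = (a * d - b * c) * deriv g z / (c * g z + d)\<^sup>2"
    by (rule DERIV_imp_deriv)
  moreover have "1 + (cmod ((a * g z + b) / (c * g z + d)))\<^sup>2 = N * (1 + (cmod (g z))\<^sup>2) / (cmod (c * g z + d))\<^sup>2"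
    using nz N(2)[of "g z"] by (simp add: norm_divide power_divide field_simps)
  ultimately show ?thesis
    using nz N(1,3) by (simp add: sharp_def norm_mult norm_divide norm_power)
qed

text \<open>Away from a pole this is the chain rule. By injectivity \<open>f\<close> has at most one pole, so the
  equality holds in a punctured neighbourhood of it, and the limit that defines the spherical
  derivative at the pole is the value of the continuous function \<open>sharp g\<close>.\<close>

lemma spherical_deriv_moebius:
  assumes u: "unitary_coeffs a b c d" and g: "g holomorphic_on ball 0 1" and inj: "inj_on f (ball 0 1)"
    and f: "\<And>z. z \<in> ball 0 1 \<Longrightarrow> f z = moebius_map a b c d (Some (g z))"
    and z: "z \<in> ball 0 1"
  shows "spherical_deriv f z = sharp g z"
proof -
  have gd: "g field_differentiable at w" if "w \<in> ball 0 1" for w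
    using g that by (simp add: holomorphic_on_imp_differentiable_at)
  have cg: "continuous_on (ball 0 1) g" using g by (rule holomorphic_on_imp_continuous_on)
  have reg: "sharp (affine_part f) w = sharp g w" if w: "w \<in> ball 0 1" "c * g w + d \<noteq> 0" for w
  proof -
    have "open (ball 0 1 \<inter> (\<lambda>w. c * g w + d) -` (- {0}))"
      by (rule continuous_open_preimage) (auto intro!: continuous_intros cg)
    hence ev: "\<forall>\<^sub>F x in nhds w. x \<in> ball 0 1 \<inter> (\<lambda>w. c * g w + d) -` (- {0})"
      by (rule eventually_nhds_in_open) (use w in auto)
    have ev': "\<forall>\<^sub>F x in nhds w. affine_part f x = (a * g x + b) / (c * g x + d)"
      using ev by eventually_elim (auto simp: affine_part_def f)
    have "sharp (affine_part f) w = sharp (\<lambda>x. (a * g x + b) / (c * g x + d)) w"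
      unfolding sharp_def deriv_cong_ev[OF ev' refl] eventually_nhds_x_imp_x[OF ev'] ..
    thus ?thesis using sharp_unitary[OF u gd w(2)] w by simp
  qed
  have sd: "spherical_deriv f z = (if f z = None then Lim (at z) (sharp (affine_part f)) else sharp (affine_part f) z)"
    by (simp add: spherical_deriv_def sharp_def[abs_def] Let_def)
  show ?thesis
  proof (cases "f z = None")
    case False
    thus ?thesis using sd reg[OF z] f[OF z] by auto
  next
    case True
    have "c * g w + d \<noteq> 0" if "w \<in> ball 0 1" "w \<noteq> z" for w
      using inj_onD[OF inj, of w z] f[OF that(1)] True that z by auto
    hence "\<forall>\<^sub>F w in at z. sharp g w = sharp (affine_part f) w"
      using z reg by (intro eventually_at_topological[THEN iffD2] exI[of _ "ball 0 1"]) auto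
    moreover have "(sharp g \<longlongrightarrow> sharp g z) (at z)"
      using continuous_on_sharp[OF g open_ball] z by (simp add: continuous_on_eq_continuous_at isCont_def)
    ultimately have "(sharp (affine_part f) \<longlongrightarrow> sharp g z) (at z)"
      by (rule Lim_transform_eventually[rotated])
    thus ?thesis using True sd by (simp add: tendsto_Lim)
  qed
qed

lemma meromorphic_map_regular:
  assumes f: "meromorphic_map_on f S" "inj_on f S" and S: "open S"
  shows "finite {z \<in> S. f z = None}" and "affine_part f holomorphic_on (S - {z \<in> S. f z = None})"
proof -
  show "finite {z \<in> S. f z = None}"
  proof (cases "\<exists>p\<in>S. f p = None")
    case True
    then obtain p where "p \<in> S" "f p = None" by auto
    hence "{z \<in> S. f z = None} \<subseteq> {p}" using f(2) by (auto simp: inj_on_def)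
    thus ?thesis by (rule finite_subset) simp
  next
    case False
    hence "{z \<in> S. f z = None} = {}" by auto
    thus ?thesis by (simp only: finite.emptyI)
  qed
  show "affine_part f holomorphic_on (S - {z \<in> S. f z = None})"
  proof (rule analytic_imp_holomorphic, subst analytic_on_analytic_at, intro ballI)
    fix z assume "z \<in> S - {z \<in> S. f z = None}"
    thus "affine_part f analytic_on {z}"
      using f(1) nicely_meromorphic_on_imp_analytic_at[of "affine_part f" S z] by (auto simp: meromorphic_map_on_def)
  qed
qed

text \<open>The assumptions on \<open>A\<close> and \<open>B\<close> say that the rotation
  \<open>w \<mapsto> (A w - B) / (cnj B w + cnj A)\<close> takes the values of \<open>f\<close> into the closed unit disc.
  The composite \<open>g\<close> extends holomorphically over the pole of \<open>f\<close>, and the maximum principle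
  keeps its values off the unit circle. The last conclusion recovers \<open>f\<close> through the inverse
  rotation.\<close>

lemma hemisphere_lift:
  assumes f: "meromorphic_map_on f (ball 0 1)" "inj_on f (ball 0 1)" and AB: "A \<noteq> 0 \<or> B \<noteq> 0"
    and pole: "\<And>z. z \<in> ball 0 1 \<Longrightarrow> f z = None \<Longrightarrow> cmod A \<le> cmod B"
    and reg: "\<And>z w. z \<in> ball 0 1 \<Longrightarrow> f z = Some w \<Longrightarrow> cmod (A * w - B) \<le> cmod (cnj B * w + cnj A)"
  obtains g where "g holomorphic_on ball 0 1" "\<And>z. z \<in> ball 0 1 \<Longrightarrow> cmod (g z) < 1"
    "\<And>z. z \<in> ball 0 1 \<Longrightarrow> f z = moebius_map (cnj A) B (- cnj B) A (Some (g z))"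
proof -
  define N where "N = (cmod A)\<^sup>2 + (cmod B)\<^sup>2"
  have N: "N > 0" using AB by (auto simp: N_def add_pos_nonneg add_nonneg_pos)
  have cN: "of_real N = A * cnj A + B * cnj B" by (simp add: N_def flip: complex_norm_square)
  have NN: "A * cnj A + B * cnj B \<noteq> 0" unfolding cN[symmetric] using N by simp
  define F where "F = affine_part f"
  define K where "K = {z \<in> ball 0 1. f z = None}"
  have K: "finite K" and hF: "F holomorphic_on ball 0 1 - K"
    using meromorphic_map_regular[OF f open_ball] by (auto simp: K_def F_def)
  define g where "g = (\<lambda>z. if f z = None then A / cnj B else (A * F z - B) / (cnj B * F z + cnj A))"
  have den: "cnj B * w + cnj A \<noteq> 0" if "z \<in> ball 0 1" "f z = Some w" for z w
  proof
    \<comment> \<open>Numerator and denominator cannot vanish together, since the determinant is not \<open>0\<close>.\<close>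
    assume 0: "cnj B * w + cnj A = 0"
    hence "A * w - B = 0" using reg[OF that] by simp
    with 0 have "A * cnj A + B * cnj B = 0" by algebra
    with NN show False by simp
  qed
  have B0: "B \<noteq> 0" if "z \<in> ball 0 1" "f z = None" for z using pole[OF that] AB by auto
  have Fv: "F z = w" if "f z = Some w" for z w using that by (simp add: F_def affine_part_def)
  have le: "cmod (g z) \<le> 1" if "z \<in> ball 0 1" for z
  proof (cases "f z")
    case None thus ?thesis using pole[OF that] B0[OF that] by (simp add: g_def norm_divide divide_le_eq_1_pos)
  next
    case (Some w) thus ?thesis using reg[OF that Some] den[OF that Some] Fv[OF Some]
      by (simp add: g_def norm_divide divide_le_eq_1_pos)
  qed
  have fg: "f z = moebius_map (cnj A) B (- cnj B) A (Some (g z))" if "z \<in> ball 0 1" for z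
  proof (cases "f z")
    case None thus ?thesis using B0[OF that] by (simp add: g_def)
  next
    case (Some w)
    define e where "e = cnj B * w + cnj A"
    have e: "e \<noteq> 0" using den[OF that Some] by (simp add: e_def)
    have gz: "g z = (A * w - B) / e" using Some Fv[OF Some] by (simp add: g_def e_def)
    have 1: "- cnj B * g z + A = of_real N / e"
      unfolding gz cN using e by (simp add: field_simps) (simp add: e_def algebra_simps)
    have 2: "cnj A * g z + B = of_real N * w / e"
      unfolding gz cN using e by (simp add: field_simps) (simp add: e_def algebra_simps)
    show ?thesis using e N Some by (simp only: moebius_map.simps 1 2) simp
  qed
  have hol: "g holomorphic_on ball 0 1"
  proof (rule no_isolated_singularity'[OF _ _ open_ball K])
    have "(\<lambda>z. (A * F z - B) / (cnj B * F z + cnj A)) holomorphic_on ball 0 1 - K"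
    proof (intro holomorphic_intros hF)
      fix z assume "z \<in> ball 0 1 - K"
      then obtain w where "z \<in> ball 0 1" "f z = Some w" by (auto simp: K_def)
      thus "cnj B * F z + cnj A \<noteq> 0" using den Fv by auto
    qed
    thus "g holomorphic_on ball 0 1 - K"
      by (rule holomorphic_transform) (auto simp: g_def K_def)
    fix p assume p: "p \<in> K"
    hence p': "p \<in> ball 0 1" "f p = None" by (auto simp: K_def)
    have "filterlim F at_infinity (at p)"
      using f(1) p' by (auto simp: meromorphic_map_on_def is_pole_def F_def)
    hence inv: "((\<lambda>z. inverse (F z)) \<longlongrightarrow> 0) (at p)"
      by (rule tendsto_inverse_0[THEN filterlim_compose])
    have "((\<lambda>z. (A - B * inverse (F z)) / (cnj B + cnj A * inverse (F z))) \<longlongrightarrow> (A - B * 0) / (cnj B + cnj A * 0)) (at p)"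
      using B0[OF p'] by (intro tendsto_intros inv) auto
    moreover have "\<forall>\<^sub>F z in at p. (A - B * inverse (F z)) / (cnj B + cnj A * inverse (F z)) = g z"
    proof -
      have "\<forall>\<^sub>F z in at p. F z \<noteq> 0"
        using \<open>filterlim F at_infinity (at p)\<close> by (rule filterlim_at_infinity_imp_eventually_ne)
      moreover have "\<forall>\<^sub>F z in at p. z \<in> ball 0 1 - {p}"
        using p' by (intro eventually_at_in_open) auto
      ultimately show ?thesis
      proof eventually_elim
        case (elim z)
        hence "f z \<noteq> None" using p' inj_onD[OF f(2), of z p] by auto
        have "(A - B * inverse (F z)) / (cnj B + cnj A * inverse (F z))
          = ((A - B * inverse (F z)) * F z) / ((cnj B + cnj A * inverse (F z)) * F z)" using elim by simp
        also have "\<dots> = g z" using \<open>f z \<noteq> None\<close> elim by (simp add: g_def algebra_simps del: not_None_eq)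
        finally show ?case .
      qed
    qed
    ultimately have "(g \<longlongrightarrow> g p) (at p)"
      by (simp add: Lim_transform_eventually g_def p')
    thus "(g \<longlongrightarrow> g p) (at p within ball 0 1)" by (rule tendsto_within_subset) simp
  qed
  have "cmod (g z) < 1" if z: "z \<in> ball 0 1" for z
  proof (rule ccontr)
    assume "\<not> cmod (g z) < 1"
    hence "g constant_on ball 0 1"
    proof (intro maximum_modulus_principle[OF hol _ _ _ order_refl z])
      fix x :: complex assume "x \<in> ball 0 1"
      with le[of x] \<open>\<not> cmod (g z) < 1\<close> show "cmod (g x) \<le> cmod (g z)" by linarith
    qed simp_all
    hence "g 0 = g (1/2)" by (auto simp: constant_on_def)
    hence "f 0 = f (1/2)" using fg[of 0] fg[of "1/2"] by simp
    with f(2) show False by (auto dest!: inj_onD)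
  qed
  from hol this fg show ?thesis by (rule that)
qed

lemma spherical_length_eq:
  assumes g: "g holomorphic_on ball 0 1" and r: "0 < r" "r < 1"
    and f: "\<And>z. z \<in> ball 0 1 \<Longrightarrow> spherical_deriv f z = sharp g z"
  shows "spherical_length f r = integral {0..2*pi} (\<lambda>t. r * sharp g (of_real r * cis t))"
proof -
  define \<phi> where "\<phi> = (\<lambda>t. r * sharp g (of_real r * cis t))"
  have "continuous_on {0..2*pi} \<phi>" unfolding \<phi>_def
    by (intro continuous_intros continuous_on_compose2[OF continuous_on_sharp[OF g open_ball]])
       (use r in \<open>auto simp: norm_mult\<close>)
  hence "(\<phi> has_integral integral {0..2*pi} \<phi>) {0..2*pi}"
    by (intro integrable_integral integrable_continuous_interval)
  hence "((\<lambda>x. \<phi> (2*pi*x)) has_integral (1 / \<bar>2*pi\<bar>) *\<^sub>R integral {0..2*pi} \<phi>) ((\<lambda>x. x / (2*pi)) ` {0..2*pi})"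
    by (intro has_integral_stretch_real) auto
  moreover have "(\<lambda>x. x / (2*pi)) ` {0..2*pi} = {0..1}"
    by (subst image_divide_atLeastAtMost) auto
  ultimately have "((\<lambda>x. \<phi> (2*pi*x) * (2*pi)) has_integral ((1 / \<bar>2*pi\<bar>) *\<^sub>R integral {0..2*pi} \<phi>) * (2*pi)) {0..1}"
    by (intro has_integral_mult_left) simp
  hence "((\<lambda>x. \<phi> (2*pi*x) * (2*pi)) has_integral integral {0..2*pi} \<phi>) {0..1}" by simp
  hence *: "integral {0..1} (\<lambda>x. \<phi> (2*pi*x) * (2*pi)) = integral {0..2*pi} \<phi>"
    by (rule integral_unique)
  have "spherical_length f r = integral {0..1} (\<lambda>x. \<phi> (2*pi*x) * (2*pi))"
    unfolding spherical_length_def arclength_integral_def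
  proof (rule Henstock_Kurzweil_Integration.integral_cong)
    fix t :: real assume t: "t \<in> {0..1}"
    have c: "circlepath 0 r t = of_real r * cis (2*pi*t)"
      by (simp add: circlepath cis_conv_exp mult_ac)
    have "of_real r * cis (2*pi*t) \<in> ball 0 1" using r by (simp add: norm_mult)
    moreover have "cmod (vector_derivative (circlepath 0 r) (at t within {0..1})) = 2 * pi * r"
      using t r by (simp add: vector_derivative_circlepath01 norm_mult)
    ultimately show "spherical_deriv f (circlepath 0 r t) * cmod (vector_derivative (circlepath 0 r) (at t within {0..1})) = \<phi> (2*pi*t) * (2*pi)"
      by (simp add: c f \<phi>_def)
  qed
  thus ?thesis using * by (simp add: \<phi>_def)
qed


section \<open>Spherically convex domains lie in a hemisphere\<close>

lemma norm_stereo: "norm (stereo a) = 1" using stereo_in_sphere[of a] by simp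

lemma snd_stereo_Some: "snd (stereo (Some z)) < 1"
proof -
  have "(cmod z)\<^sup>2 + 1 > 0" by (simp add: add_nonneg_pos)
  thus ?thesis by (simp add: divide_less_eq)
qed

lemma stereo_inverse:
  assumes q: "norm q = 1" "snd q \<noteq> 1"
  shows "stereo (Some (fst q /\<^sub>R (1 - snd q))) = q"
proof -
  obtain w t where qe: "q = (w, t)" by force
  have n: "(cmod w)\<^sup>2 + t\<^sup>2 = 1" using q(1) by (simp add: qe norm_Pair)
  have t: "t \<noteq> 1" using q by (simp add: qe)
  have "(cmod (w /\<^sub>R (1 - t)))\<^sup>2 = (1 - t\<^sup>2) / (1 - t)\<^sup>2"
    using n by (simp add: power_divide norm_inverse field_simps)
  also have "1 - t\<^sup>2 = (1 + t) * (1 - t)" by (simp add: power2_eq_square algebra_simps)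
  also have "\<dots> / (1 - t)\<^sup>2 = (1 + t) / (1 - t)" using t by (simp add: power2_eq_square)
  finally have s: "(cmod (w /\<^sub>R (1 - t)))\<^sup>2 = (1 + t) / (1 - t)" .
  have "2 / (1 + (1 + t) / (1 - t)) = 1 - t" "((1 + t) / (1 - t) - 1) / ((1 + t) / (1 - t) + 1) = t"
    using t by (simp_all add: field_simps)
  thus ?thesis using t unfolding stereo.simps qe fst_conv snd_conv s by simp
qed

lemma stereo_surj: "norm q = 1 \<Longrightarrow> \<exists>a. stereo a = q"
proof (cases "snd q = 1")
  case True
  assume "norm q = 1"
  hence "q = (0, 1)" using True by (cases q) (auto simp: norm_Pair)
  thus ?thesis by (intro exI[of _ None]) simp
qed (use stereo_inverse in blast)

lemma stereo_inj: "stereo a = stereo b \<Longrightarrow> a = b"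
proof -
  have S: "fst (stereo (Some z)) /\<^sub>R (1 - snd (stereo (Some z))) = z" for z
  proof -
    define k where "k = 1 + (cmod z)\<^sup>2"
    have k: "k \<noteq> 0" using one_plus_norm_sq_ne0 by (simp add: k_def)
    have "(cmod z)\<^sup>2 + 1 \<noteq> 0" using one_plus_norm_sq_ne0[of z] by (simp add: add.commute)
    hence "1 - ((cmod z)\<^sup>2 - 1) / ((cmod z)\<^sup>2 + 1) = 2 / (1 + (cmod z)\<^sup>2)" by (simp add: field_simps)
    hence "fst (stereo (Some z)) = (2 / k) *\<^sub>R z" "1 - snd (stereo (Some z)) = 2 / k" by (simp_all add: k_def)
    thus ?thesis using k by (simp del: stereo.simps)
  qed
  show "stereo a = stereo b \<Longrightarrow> a = b"
    using S snd_stereo_Some by (cases a; cases b) (metis less_irrefl snd_conv stereo.simps(1))+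
qed

text \<open>Let \<open>p\<close> and \<open>-p\<close> be in the domain. A third point \<open>x\<close> lies on a half circle from \<open>p\<close>
  to \<open>-p\<close>. Moving \<open>p\<close> slightly towards \<open>x\<close> on it gives a point \<open>q t\<close> which by
  openness is still in the domain, is no longer antipodal to \<open>-p\<close>, and has \<open>x\<close> on its geodesic
  to \<open>-p\<close>. Of two antipodal points one is finite; taking that one as \<open>p\<close> keeps the
  argument inside the plane, where \<open>stereo_inverse\<close> gives the required continuity.\<close>

lemma antipodal_imp_UNIV:
  assumes \<Omega>: "spherically_convex_domain \<Omega>" and a: "a \<in> \<Omega>" and b: "b \<in> \<Omega>" and anti: "antipodal a b"
  shows "\<Omega> = UNIV"
proof -
  have *: "\<Omega> = UNIV" if z: "Some z \<in> \<Omega>" and c: "c \<in> \<Omega>" and ac: "stereo c = - stereo (Some z)" for z c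
  proof -
    define p where "p = stereo (Some z)"
    have p1: "norm p = 1" "snd p < 1" unfolding p_def by (rule norm_stereo, rule snd_stereo_Some)
    have "openin euclidean {x \<in> topspace euclidean. Some x \<in> \<Omega>}"
      using \<Omega> unfolding spherically_convex_domain_def rsphere_top_def
      by (blast intro: openin_continuous_map_preimage[OF continuous_map_Some])
    hence openV: "open {x. Some x \<in> \<Omega>}" by (simp flip: open_openin)
    have "x \<in> \<Omega>" for x
    proof (cases "stereo x = p \<or> stereo x = - p")
      case True
      thus ?thesis
      proof
        assume "stereo x = p"
        hence "x = Some z" unfolding p_def by (rule stereo_inj)
        thus ?thesis using z by simp
      next
        assume "stereo x = - p"
        hence "x = c" unfolding p_def ac[symmetric] by (rule stereo_inj)
        thus ?thesis using c by simp
      qed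
    next
      case False
      define x' where "x' = stereo x"
      have x1: "norm x' = 1" unfolding x'_def by (rule norm_stereo)
      have xp: "x' \<noteq> p" "x' \<noteq> - p" using False by (auto simp: x'_def)
      define m where "m = (\<lambda>t::real. p + t *\<^sub>R x')"
      define q where "q = (\<lambda>t. m t /\<^sub>R norm (m t))"
      define w where "w = (\<lambda>t. fst (q t) /\<^sub>R (1 - snd (q t)))"
      have m0: "norm (m t) > 0" if "t \<noteq> 1" "t \<ge> 0" for t
      proof -
        have "m t \<noteq> 0"
        proof
          assume "m t = 0"
          hence "p = - (t *\<^sub>R x')" unfolding m_def by (simp add: eq_neg_iff_add_eq_0)
          hence "norm p = t * norm x'" using that by simp
          with p1 x1 that show False by simp
        qed
        thus ?thesis by simp
      qed
      have q0: "q 0 = p" using p1 by (simp add: q_def m_def)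
      have mt: "(m \<longlongrightarrow> m 0) (at_right 0)" unfolding m_def by (intro tendsto_intros)
      hence qt: "(q \<longlongrightarrow> q 0) (at_right 0)" unfolding q_def
        using p1 by (intro tendsto_intros) (auto simp: m_def)
      have wt: "(w \<longlongrightarrow> w 0) (at_right 0)" unfolding w_def
        using qt p1 q0 by (intro tendsto_intros) auto
      have "w 0 = z" using stereo_inj[of "Some (w 0)" "Some z"] stereo_inverse[of p] p1
        by (simp add: w_def q0 p_def del: stereo.simps)
      hence "\<forall>\<^sub>F t in at_right 0. w t \<in> {x. Some x \<in> \<Omega>}"
        using wt z openV by (intro topological_tendstoD) auto
      moreover have "\<forall>\<^sub>F t in at_right 0. snd (q t) < 1"
        using tendsto_snd[OF qt] p1 q0 by (intro order_tendstoD(2)) auto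
      moreover have "\<forall>\<^sub>F t in at_right 0. t \<in> {0<..<(1::real)}"
        by (rule eventually_at_right_real) simp
      ultimately have "\<forall>\<^sub>F t in at_right (0::real). Some (w t) \<in> \<Omega> \<and> snd (q t) < 1 \<and> t \<in> {0<..<1}"
        by eventually_elim auto
      then obtain t where t: "Some (w t) \<in> \<Omega>" "snd (q t) < 1" "0 < t" "t < 1"
        using eventually_happens'[OF trivial_limit_at_right_real] by auto
      define n where "n = norm (m t)"
      have n: "n > 0" unfolding n_def using m0 t by auto
      have nq: "n *\<^sub>R q t = p + t *\<^sub>R x'" using n by (simp add: q_def n_def m_def)
      have "norm (q t) = 1" using n by (simp add: q_def n_def)
      hence sw: "stereo (Some (w t)) = q t" using stereo_inverse[of "q t"] t by (simp add: w_def del: stereo.simps)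
      have "\<not> antipodal c (Some (w t))"
      proof
        assume "antipodal c (Some (w t))"
        hence "q t = p" using ac sw by (simp add: antipodal_def p_def del: stereo.simps)
        hence tx: "t *\<^sub>R x' = (n - 1) *\<^sub>R p" using nq by (simp add: algebra_simps)
        have "\<bar>n - 1\<bar> = t" using arg_cong[OF tx, of norm] p1 x1 t by simp
        hence "n - 1 = t \<or> n - 1 = - t" by linarith
        thus False
        proof
          assume "n - 1 = t"
          hence "t *\<^sub>R x' = t *\<^sub>R p" using tx by simp
          thus False using t xp(1) by (simp only: scaleR_cancel_left) simp
        next
          assume "n - 1 = - t"
          hence "t *\<^sub>R x' = t *\<^sub>R (- p)" using tx by simp
          thus False using t xp(2) by (simp only: scaleR_cancel_left) simp
        qed
      qed
      hence geo: "spherical_geodesic c (Some (w t)) \<subseteq> \<Omega>"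
        using \<Omega> c t(1) unfolding spherically_convex_domain_def by blast
      define k where "k = n + 1"
      have "x' = sgn ((t / k) *\<^sub>R x')" using n t x1 by (simp add: sgn_div_norm k_def)
      moreover have "(t / k) *\<^sub>R x' \<in> closed_segment (stereo c) (stereo (Some (w t)))"
      proof -
        have "(t / k) *\<^sub>R x' = (1 / k) *\<^sub>R (n *\<^sub>R q t - p)" unfolding nq by simp
        also have "\<dots> = (1 - n / k) *\<^sub>R stereo c + (n / k) *\<^sub>R stereo (Some (w t))"
        proof -
          have e: "1 - n / k = 1 / k" using n by (simp add: k_def field_simps)
          show ?thesis unfolding sw ac p_def[symmetric] e by (simp add: scaleR_diff_right)
        qed
        finally have e: "(t / k) *\<^sub>R x' = (1 - n / k) *\<^sub>R stereo c + (n / k) *\<^sub>R stereo (Some (w t))" .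
        have "0 \<le> n / k" "n / k \<le> 1" using n by (simp_all add: k_def)
        with e show ?thesis unfolding closed_segment_def by blast
      qed
      ultimately have "x \<in> spherical_geodesic c (Some (w t))"
        unfolding spherical_geodesic_def mem_Collect_eq x'_def by (rule image_eqI)
      with geo show ?thesis by blast
    qed
    thus ?thesis by auto
  qed
  show ?thesis
  proof (cases a)
    case (Some z)
    thus ?thesis using *[of z b] a b anti by (simp add: antipodal_def del: stereo.simps)
  next
    case None
    then obtain z where "b = Some z" using anti by (cases b) (auto simp: antipodal_def)
    thus ?thesis using *[of z a] a b anti by (simp add: antipodal_def del: stereo.simps)
  qed
qed

text \<open>Spherical convexity means that the cone over the domain is convex in space. In the absence of
  antipodal points the cone does not contain \<open>0\<close>, so a plane through \<open>0\<close> has it on one side.\<close>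

lemma supporting_hemisphere:
  assumes \<Omega>: "spherically_convex_domain \<Omega>" and ne: "\<Omega> \<noteq> UNIV"
  obtains c where "c \<noteq> 0" "\<And>x. x \<in> \<Omega> \<Longrightarrow> 0 \<le> inner c (stereo x)"
proof -
  define K where "K = {s *\<^sub>R stereo x | s x. s > 0 \<and> x \<in> \<Omega>}"
  have "0 \<notin> K" using norm_stereo by (auto simp: K_def) (metis norm_zero zero_neq_one)
  moreover have "convex K"
  proof (rule convexI)
    fix P Q and u v :: real assume PQ: "P \<in> K" "Q \<in> K" and uv: "0 \<le> u" "0 \<le> v" "u + v = 1"
    obtain s x where P: "P = s *\<^sub>R stereo x" "s > 0" "x \<in> \<Omega>" using PQ by (auto simp: K_def)
    obtain t y where Q: "Q = t *\<^sub>R stereo y" "t > 0" "y \<in> \<Omega>" using PQ by (auto simp: K_def)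
    define k where "k = u * s + v * t"
    have k: "k > 0" using uv P(2) Q(2) unfolding k_def
      by (cases "u = 0") (auto intro!: add_pos_nonneg)
    define M where "M = (1 / k) *\<^sub>R (u *\<^sub>R P + v *\<^sub>R Q)"
    have Meq: "M = (1 - v * t / k) *\<^sub>R stereo x + (v * t / k) *\<^sub>R stereo y"
    proof -
      have "1 - v * t / k = u * s / k" using k by (simp add: k_def field_simps)
      moreover have "M = (u * s / k) *\<^sub>R stereo x + (v * t / k) *\<^sub>R stereo y"
        by (simp add: M_def P Q scaleR_add_right)
      ultimately show ?thesis by simp
    qed
    have vk: "0 \<le> v * t / k" "v * t / k \<le> 1" using k uv P Q by (auto simp: k_def)
    have seg: "M \<in> closed_segment (stereo x) (stereo y)"
      unfolding closed_segment_def using Meq vk by auto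
    have na: "\<not> antipodal x y" using antipodal_imp_UNIV[OF \<Omega> P(3) Q(3)] ne by auto
    have M0: "M \<noteq> 0"
    proof
      assume "M = 0"
      define l where "l = v * t / k"
      have e: "l *\<^sub>R stereo y = - ((1 - l) *\<^sub>R stereo x)" using Meq \<open>M = 0\<close> by (simp add: l_def eq_neg_iff_add_eq_0 add.commute)
      have "\<bar>l\<bar> = \<bar>1 - l\<bar>" using arg_cong[OF e, of norm] by (simp add: norm_stereo)
      hence l: "l = 1/2" by linarith
      have "(1/2) *\<^sub>R stereo y = (1/2) *\<^sub>R (- stereo x)" using e unfolding l by simp
      hence "stereo y = - stereo x" by (simp only: scaleR_cancel_left) simp
      thus False using na by (simp add: antipodal_def)
    qed
    obtain w where w: "stereo w = sgn M" using stereo_surj[of "sgn M"] M0 by (auto simp: norm_sgn)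
    have "w \<in> spherical_geodesic x y" using w seg by (auto simp: spherical_geodesic_def)
    hence "w \<in> \<Omega>" using \<Omega> P Q na unfolding spherically_convex_domain_def by blast
    moreover have "u *\<^sub>R P + v *\<^sub>R Q = (k * norm M) *\<^sub>R stereo w"
      using k M0 unfolding w by (simp add: sgn_div_norm) (simp add: M_def)
    moreover have "k * norm M > 0" using k M0 by simp
    ultimately show "u *\<^sub>R P + v *\<^sub>R Q \<in> K" unfolding K_def by blast
  qed
  ultimately obtain c where c: "c \<noteq> 0" "\<forall>x\<in>K. 0 \<le> inner c x"
    using separating_hyperplane_set_0 by blast
  show ?thesis
  proof (rule that[OF c(1)])
    fix x assume "x \<in> \<Omega>"
    hence "1 *\<^sub>R stereo x \<in> K" unfolding K_def using zero_less_one by blast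
    thus "0 \<le> inner c (stereo x)" using c(2) by auto
  qed
qed

text \<open>Expanding \<open>|cnj B w + cnj A|\<^sup>2 - |A w - B|\<^sup>2\<close> for real \<open>A\<close> gives a positive multiple of the
  inner product of \<open>c\<close> with the image of \<open>w\<close> on the sphere, provided that
  \<open>(2 A B, |B|\<^sup>2 - A\<^sup>2)\<close> is a positive multiple of \<open>c\<close>. This is solved by \<open>A = |c| - c2\<close> and
  \<open>B = c1\<close>, except when \<open>c\<close> points to \<open>\<infinity>\<close>, where \<open>A = 0\<close> and \<open>B = 1\<close> serve.\<close>

lemma hemisphere_coeffs:
  fixes c :: "complex \<times> real"
  assumes c: "c \<noteq> 0"
  obtains A B where "A \<noteq> 0 \<or> B \<noteq> 0" "0 \<le> inner c (stereo None) \<Longrightarrow> cmod A \<le> cmod B"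
    "\<And>w. 0 \<le> inner c (stereo (Some w)) \<Longrightarrow> cmod (A * w - B) \<le> cmod (cnj B * w + cnj A)"
proof -
  obtain c1 c2 where ce: "c = (c1, c2)" by force
  define n where "n = norm c"
  have n: "n > 0" "n\<^sup>2 = (cmod c1)\<^sup>2 + c2\<^sup>2"
    using c by (simp add: n_def, simp add: n_def ce norm_Pair)
  have "c2\<^sup>2 \<le> n\<^sup>2" using n by simp
  hence c2n: "c2 \<le> n" using n(1) by (rule power2_le_imp_le[OF _ less_imp_le])
  obtain a B k where aB: "complex_of_real a \<noteq> 0 \<or> B \<noteq> 0" and k: "k > 0" and
     e1: "(cmod B)\<^sup>2 - a\<^sup>2 = k * c2" and e2: "2 * of_real a * B = of_real k * c1"
  proof (cases "c2 = n")
    case True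
    have "(cmod c1)\<^sup>2 = 0" using n(2) unfolding True by linarith
    hence "c1 = 0" by simp
    thus ?thesis using True n(1) by (intro that[of 0 1 "1 / n"]) auto
  next
    case False
    hence "c2 < n" using c2n by simp
    thus ?thesis using n
      by (intro that[of "n - c2" c1 "2 * (n - c2)"]) (auto simp: power2_eq_square algebra_simps)
  qed
  define A where "A = complex_of_real a"
  show ?thesis
  proof (rule that)
    show "A \<noteq> 0 \<or> B \<noteq> 0" using aB by (simp add: A_def)
    assume "0 \<le> inner c (stereo None)"
    hence "0 \<le> k * c2" using k by (simp add: ce)
    hence "a\<^sup>2 \<le> (cmod B)\<^sup>2" using e1 by linarith
    thus "cmod A \<le> cmod B" using power2_le_imp_le[of "cmod A" "cmod B"] by (simp add: A_def)
  next
    fix w assume "0 \<le> inner c (stereo (Some w))"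
    have p: "1 + (cmod w)\<^sup>2 > 0" by (simp add: add_pos_nonneg)
    have "0 \<le> inner c (stereo (Some w)) * (1 + (cmod w)\<^sup>2)" using p \<open>0 \<le> inner c _\<close> by simp
    also have "\<dots> = 2 * inner c1 w + c2 * ((cmod w)\<^sup>2 - 1)"
    proof -
      define q where "q = 1 + (cmod w)\<^sup>2"
      have q: "q \<noteq> 0" "(cmod w)\<^sup>2 = q - 1" using p by (auto simp: q_def)
      show ?thesis unfolding ce stereo.simps inner_Pair q(2) using q(1)
        by (simp add: field_simps)
    qed
    finally have "0 \<le> k * (2 * inner c1 w + c2 * ((cmod w)\<^sup>2 - 1))" using k by simp
    also have "\<dots> = 2 * inner (of_real k * c1) w + (k * c2) * ((cmod w)\<^sup>2 - 1)"
      by (simp add: inner_complex_def algebra_simps)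
    also have "\<dots> = 4 * a * inner B w + ((cmod B)\<^sup>2 - a\<^sup>2) * ((cmod w)\<^sup>2 - 1)"
      unfolding e1[symmetric] e2[symmetric] by (simp add: inner_complex_def algebra_simps)
    also have "\<dots> = (cmod (cnj B * w + cnj A))\<^sup>2 - (cmod (A * w - B))\<^sup>2"
      unfolding cmod_power2 by (simp add: A_def inner_complex_def power2_eq_square algebra_simps)
    finally show "cmod (A * w - B) \<le> cmod (cnj B * w + cnj A)"
      by (simp add: power2_le_iff_abs_le)
  qed
qed

text \<open>Otherwise the inverse of \<open>f\<close> would be a bounded entire function on the finite plane, hence
  constant by Liouville's theorem.\<close>

lemma image_ne_UNIV:
  assumes f: "meromorphic_map_on f (ball 0 1)" "inj_on f (ball 0 1)"
  shows "f ` ball 0 1 \<noteq> UNIV"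
proof
  assume surj: "f ` ball 0 1 = UNIV"
  define K where "K = {z \<in> ball 0 1. f z = None}"
  define F where "F = affine_part f"
  have hF: "F holomorphic_on ball 0 1 - K" and K: "finite K"
    using meromorphic_map_regular[OF f open_ball] by (auto simp: K_def F_def)
  have Fv: "f z = Some (F z)" if "z \<in> ball 0 1 - K" for z
    using that by (auto simp: K_def F_def affine_part_def)
  have inj: "inj_on F (ball 0 1 - K)"
    using f(2) Fv by (metis (no_types, lifting) DiffD1 inj_on_def)
  have im: "F ` (ball 0 1 - K) = UNIV"
  proof (intro equalityI subsetI)
    fix w :: complex
    have "Some w \<in> f ` ball 0 1" using surj by simp
    then obtain z where "z \<in> ball 0 1" "f z = Some w" by auto
    thus "w \<in> F ` (ball 0 1 - K)" using Fv[of z] by (intro image_eqI[of _ _ z]) (auto simp: K_def)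
  qed simp
  obtain g where g: "g holomorphic_on F ` (ball 0 1 - K)" "\<And>z. z \<in> ball 0 1 - K \<Longrightarrow> g (F z) = z"
    using holomorphic_has_inverse[OF hF _ inj] K by (metis finite_imp_closed open_Diff open_ball)
  have "range g = g ` F ` (ball 0 1 - K)" unfolding im ..
  also have "\<dots> \<subseteq> ball 0 1" using g(2) by auto
  finally have "range g \<subseteq> ball 0 1" .
  hence "bounded (range g)" by (rule bounded_subset[OF bounded_ball])
  moreover have "g holomorphic_on UNIV" using g(1) unfolding im .
  ultimately have "g constant_on UNIV" by (intro Liouville_theorem)
  then obtain k where k: "\<And>w. g w = k" by (auto simp: constant_on_def)
  hence "ball 0 1 - K \<subseteq> {k}" using g(2) by auto
  hence "finite (ball (0::complex) 1)" using K by (metis finite.emptyI finite.insertI finite_Diff2 finite_subset)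
  thus False using finite_imp_not_open[of "ball (0::complex) 1"] by simp
qed


section \<open>The length of the image of a circle\<close>

lemma Rot_unitary:
  assumes "T \<in> Rot"
  obtains a b c d where "T = moebius_map a b c d" "unitary_coeffs a b c d"
proof -
  from assms consider a \<theta> where "T = moebius_map (cis \<theta>) (- cis \<theta> * a) (cnj a) 1"
    | \<theta> where "T = moebius_map 0 (cis \<theta>) 1 0"
    unfolding Rot_def by blast
  thus ?thesis
  proof cases
    case 1
    have "unitary_coeffs (cis \<theta>) (- cis \<theta> * a) (cnj a) 1"
      by (auto simp: unitary_coeffs_def norm_mult cis_cnj mult_ac cis_mult)
    with 1 show ?thesis by (rule that)
  next
    case 2
    have "unitary_coeffs 0 (cis \<theta>) 1 0" by (simp add: unitary_coeffs_def)
    with 2 show ?thesis by (rule that)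
  qed
qed

lemma spherical_length_rotation:
  assumes inj: "inj_on f (ball 0 1)" and T: "T \<in> Rot"
    and f: "\<And>z. z \<in> ball 0 1 \<Longrightarrow> f z = T (Some (\<eta> * z))" and r: "0 < r" "r < 1"
  shows "spherical_length f r = 2 * pi * r * spherical_deriv f 0 / (1 + r\<^sup>2 * (spherical_deriv f 0)\<^sup>2)"
proof -
  define g where "g = (\<lambda>z. \<eta> * z)"
  have g: "g holomorphic_on ball 0 1" unfolding g_def by (intro holomorphic_intros)
  obtain a b c d where M: "T = moebius_map a b c d" "unitary_coeffs a b c d" using Rot_unitary[OF T] .
  have sd: "spherical_deriv f z = sharp g z" if "z \<in> ball 0 1" for z
    by (rule spherical_deriv_moebius[OF M(2) g inj _ that]) (simp add: f M(1) g_def)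
  have "deriv g z = \<eta>" for z unfolding g_def by (rule DERIV_imp_deriv) (auto intro!: derivative_eq_intros)
  hence sg: "sharp g z = cmod \<eta> / (1 + (cmod \<eta>)\<^sup>2 * (cmod z)\<^sup>2)" for z
    by (simp add: sharp_def g_def norm_mult power_mult_distrib)
  show ?thesis
    using spherical_length_eq[OF g r sd] r sd[of 0]
    by (simp add: sg norm_mult mult_ac)
qed

theorem theorem1p4:
  fixes f :: "complex \<Rightarrow> rsphere"
  assumes "spherically_convex f"
  shows "(\<forall>r. 0 < r \<and> r < 1 \<longrightarrow>
            spherical_length f r \<ge>
              2 * pi * r * spherical_deriv f 0 / (1 + r\<^sup>2 * (spherical_deriv f 0)\<^sup>2))
       \<and> (\<forall>T \<eta>. T \<in> Rot \<and> 0 < cmod \<eta> \<and> cmod \<eta> \<le> 1 \<and>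
              (\<forall>z\<in>ball 0 1. f z = T (Some (\<eta> * z))) \<longrightarrow>
            (\<forall>r. 0 < r \<and> r < 1 \<longrightarrow>
              spherical_length f r =
                2 * pi * r * spherical_deriv f 0 / (1 + r\<^sup>2 * (spherical_deriv f 0)\<^sup>2)))"
proof -
  have f: "meromorphic_map_on f (ball 0 1)" "inj_on f (ball 0 1)" "spherically_convex_domain (f ` ball 0 1)"
    using assms by (auto simp: spherically_convex_def)
  obtain c where c: "c \<noteq> 0" "\<And>x. x \<in> f ` ball 0 1 \<Longrightarrow> 0 \<le> inner c (stereo x)"
    using supporting_hemisphere[OF f(3) image_ne_UNIV[OF f(1,2)]] by metis
  obtain A B where AB: "A \<noteq> 0 \<or> B \<noteq> 0" "0 \<le> inner c (stereo None) \<Longrightarrow> cmod A \<le> cmod B"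
    "\<And>w. 0 \<le> inner c (stereo (Some w)) \<Longrightarrow> cmod (A * w - B) \<le> cmod (cnj B * w + cnj A)"
    using hemisphere_coeffs[OF c(1)] by metis
  obtain g where g: "g holomorphic_on ball 0 1" "\<And>z. z \<in> ball 0 1 \<Longrightarrow> cmod (g z) < 1"
    "\<And>z. z \<in> ball 0 1 \<Longrightarrow> f z = moebius_map (cnj A) B (- cnj B) A (Some (g z))"
  proof (rule hemisphere_lift[OF f(1,2) AB(1)])
    show "cmod A \<le> cmod B" if "z \<in> ball 0 1" "f z = None" for z
      using AB(2) c(2)[OF imageI[OF that(1)]] that(2) by simp
    show "cmod (A * w - B) \<le> cmod (cnj B * w + cnj A)" if "z \<in> ball 0 1" "f z = Some w" for z w
      using AB(3)[of w] c(2)[OF imageI[OF that(1)]] that(2) by (simp del: stereo.simps)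
  qed (rule that)
  have "unitary_coeffs (cnj A) B (- cnj B) A" using AB(1) by (auto simp: unitary_coeffs_def mult_ac)
  hence sd: "spherical_deriv f z = sharp g z" if "z \<in> ball 0 1" for z
    using spherical_deriv_moebius[OF _ g(1) f(2) g(3) that] by blast
  have "2 * pi * r * spherical_deriv f 0 / (1 + r\<^sup>2 * (spherical_deriv f 0)\<^sup>2) \<le> spherical_length f r"
    if r: "0 < r" "r < 1" for r
    using circle_length_lower_bound[OF g(1,2) r] spherical_length_eq[OF g(1) r sd] sd[of 0] by simp
  moreover have "spherical_length f r = 2 * pi * r * spherical_deriv f 0 / (1 + r\<^sup>2 * (spherical_deriv f 0)\<^sup>2)"
    if T: "T \<in> Rot" "\<forall>z\<in>ball 0 1. f z = T (Some (\<eta> * z))" and r: "0 < r" "r < 1" for T \<eta> r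
    by (rule spherical_length_rotation[OF f(2) T(1) _ r]) (use T(2) in blast)
  ultimately show ?thesis by blast
qed

end
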